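(* Let $m\ge 3$ and let $A\in\mathrm{Ext}(m,F(0,3,1,0))$. Then every component $C_i$ of the undirected-edge graph of $G(A)$ is a clique (every two of its vertices are joined by an undirected edge), and: (i) if $m\equiv 0\pmod 3$, all components have size $3$; (ii) if $m\equiv 1\pmod 3$, one component has size $4$ and all others have size $3$; (iii) if $m\equiv 2\pmod 3$, either one component has size $5$ and all others have size $3$, or two components have size $4$ and all others have size $3$. Moreover, up to row and column permutations, for a component $C_i$ of size $3$ we have $B_i=K_3$ with the column of all 1's removed; for a component of size $4$, $B_i=[K_4^0K_4^1K_4^3]$; and for a component of size $5$, $B_i=[K_5^0K_5^1K_5^4]$.
   Context: A matrix is simple if it is a $(0,1)$-matrix with no repeated columns. $F\prec A$ means some submatrix of $A$ is a row and column permutation of $F$. $\mathrm{Avoid}(m,F)$ is the set of simple $m$-rowed matrices $A$ with $F\not\prec A$; $\mathrm{forb}(m,F)$ is the maximum number of columns of a matrix in $\mathrm{Avoid}(m,F)$; $\mathrm{Ext}(m,F)$ is the set of $A\in\mathrm{Avoid}(m,F)$ with exactly $\mathrm{forb}(m,F)$ columns. $F(0,p,1,0)$ is the $2\times(p+1)$ matrix with $p$ columns $\binom{1}{0}$ and one column $\binom{0}{1}$. $K_k$ is the $k\times 2^k$ matrix of all $(0,1)$-columns of length $k$, and $K_k^s$ is the $k\times\binom ks$ matrix of all columns with column sum $s$. For $A\in\mathrm{Avoid}(m,F(0,p,1,0))$ define the graph $G(A)$ on the rows of $A$: there is a directed edge $i\to j$ if there is no column of $A$ with $0$ in row $i$ and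 $1$ in row $j$; there is an undirected edge $i-j$ if there are at most $p-1$ columns with $0$ in row $i$ and $1$ in row $j$ and at most $p-1$ columns with $1$ in row $i$ and $0$ in row $j$, except that if a directed edge between $i$ and $j$ is present the undirected edge is ignored. The components $C_1,C_2,\dots$ are the connected components of the graph formed by the undirected edges. For a component $C_i$, $B_i$ is the submatrix of $A$ restricted to the rows $C_i$ consisting of the columns that are non-constant on $C_i$, together with the all-0 column on $C_i$ if $A$ has a column that is all 0 on $C_i$. *)

theory Defs
  imports "Jordan_Normal_Form.Matrix" "Jordan_Normal_Form.DL_Submatrix"
    "HOL-Combinatorics.Permutations"
begin

text \<open>Forbidden configurations. Matrices are of type \<^typ>\<open>nat mat\<close>; rows and columns are
  numbered from 0.\<close>

definition simple_mat :: "nat mat \<Rightarrow> bool" where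
  "simple_mat A \<longleftrightarrow> elements_mat A \<subseteq> {0, 1} \<and> distinct (cols A)"

definition perm_equiv :: "'a mat \<Rightarrow> 'a mat \<Rightarrow> bool" where
  "perm_equiv A B \<longleftrightarrow> dim_row A = dim_row B \<and> dim_col A = dim_col B \<and>
     (\<exists>p q. p permutes {..<dim_row A} \<and> q permutes {..<dim_col A} \<and>
        (\<forall>i<dim_row A. \<forall>j<dim_col A. A $$ (i, j) = B $$ (p i, q j)))"

definition configuration :: "'a mat \<Rightarrow> 'a mat \<Rightarrow> bool"  (infix \<open>\<prec>\<close> 50) where
  "F \<prec> A \<longleftrightarrow> (\<exists>I J. perm_equiv (submatrix A I J) F)"

definition Avoid :: "nat \<Rightarrow> nat mat \<Rightarrow> nat mat set" where
  "Avoid m F = {A. simple_mat A \<and> dim_row A = m \<and> \<not> F \<prec> A}"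

text \<open>A simple matrix with \<open>m\<close> rows has at most \<open>2 ^ m\<close> columns, so the maximum is over a finite
  set.\<close>

definition forb :: "nat \<Rightarrow> nat mat \<Rightarrow> nat" where
  "forb m F = Max (dim_col ` Avoid m F)"

definition Ext :: "nat \<Rightarrow> nat mat \<Rightarrow> nat mat set" where
  "Ext m F = {A \<in> Avoid m F. dim_col A = forb m F}"

text \<open>\<open>F0p10 p\<close> is \<open>F(0,p,1,0)\<close>: \<open>p\<close> columns (1,0) followed by one column (0,1).\<close>

definition F0p10 :: "nat \<Rightarrow> nat mat" where
  "F0p10 p = mat_of_cols_list 2 (replicate p [1, 0] @ [[0, 1]])"

definition K :: "nat \<Rightarrow> nat mat" where
  "K k = mat_of_cols_list k (product_lists (replicate k [0, 1]))"

definition Ks :: "nat \<Rightarrow> nat \<Rightarrow> nat mat" where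
  "Ks k s = mat_of_cols k (filter (\<lambda>v. sum_list (list_of_vec v) = s) (cols (K k)))"

definition K_without_ones :: "nat \<Rightarrow> nat mat" where
  "K_without_ones k = mat_of_cols k (removeAll (vec k (\<lambda>_. 1)) (cols (K k)))"

definition hconcat :: "'a mat \<Rightarrow> 'a mat \<Rightarrow> 'a mat"  (infixr \<open>|||\<close> 65) where
  "A ||| B = mat_of_cols (dim_row A) (cols A @ cols B)"

definition cols01 :: "nat mat \<Rightarrow> nat \<Rightarrow> nat \<Rightarrow> nat set" where
  "cols01 A i j = {c. c < dim_col A \<and> A $$ (i, c) = 0 \<and> A $$ (j, c) = 1}"

definition directed_edge :: "nat mat \<Rightarrow> nat \<Rightarrow> nat \<Rightarrow> bool" where
  "directed_edge A i j \<longleftrightarrow> i < dim_row A \<and> j < dim_row A \<and> i \<noteq> j \<and> cols01 A i j = {}"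

text \<open>The parameter \<open>p\<close> is that of \<open>F(0,p,1,0)\<close>. Writing \<open>< p\<close> for ``at most \<open>p - 1\<close>'' avoids
  truncated subtraction.\<close>

definition undirected_edge :: "nat \<Rightarrow> nat mat \<Rightarrow> nat \<Rightarrow> nat \<Rightarrow> bool" where
  "undirected_edge p A i j \<longleftrightarrow> i < dim_row A \<and> j < dim_row A \<and> i \<noteq> j \<and>
     card (cols01 A i j) < p \<and> card (cols01 A j i) < p \<and>
     \<not> directed_edge A i j \<and> \<not> directed_edge A j i"

text \<open>The edge relation is symmetric, so its reflexive transitive closure is an equivalence relation;
  its classes of row indices are the connected components (isolated rows included).\<close>

definition components :: "nat \<Rightarrow> nat mat \<Rightarrow> nat set set" where
  "components p A = {..<dim_row A} // {(i, j). undirected_edge p A i j}\<^sup>*"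

definition nonconstant_cols :: "nat mat \<Rightarrow> nat set \<Rightarrow> nat set" where
  "nonconstant_cols A C = {c. c < dim_col A \<and> (\<exists>i\<in>C. \<exists>j\<in>C. A $$ (i, c) \<noteq> A $$ (j, c))}"

definition zero_cols :: "nat mat \<Rightarrow> nat set \<Rightarrow> nat set" where
  "zero_cols A C = {c. c < dim_col A \<and> (\<forall>i\<in>C. A $$ (i, c) = 0)}"

text \<open>Every column of \<open>A\<close> that is non-constant on \<open>C\<close> contributes a column to the block, so these are
  counted with multiplicity. All columns that are zero on \<open>C\<close> together contribute a single zero
  column, for which the first of them is used.\<close>

definition block :: "nat mat \<Rightarrow> nat set \<Rightarrow> nat mat" where
  "block A C = submatrix A C
     (nonconstant_cols A C \<union>
      (if zero_cols A C = {} then {} else {LEAST c. c \<in> zero_cols A C}))"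

end

theory Submission
  imports Defs
begin

text \<open>Identify a simple matrix with the family of supports of its columns. Forbidding \<open>F(0,3,1,0)\<close>
  means that any two rows are joined by a directed or an undirected edge. Distinct components are
  linearly ordered by the directed edges, so a column that is non-constant on one component is
  constant on every other one and is determined by its trace, and the columns that are constant on
  all components form a chain. If \<open>N(C)\<close> columns are non-constant on \<open>C\<close>, the number of columns is
  therefore at most the sum of all \<open>N(C) + 1\<close>, plus one.

  If \<open>C\<close> is a clique with \<open>n\<close> elements, double counting the triples of a column \<open>S\<close>, an element
  of \<open>C\<close> in \<open>S\<close> and one outside \<open>S\<close> gives \<open>N(C) \<le> 2n\<close>, with equality only if all traces are
  singletons or complements of singletons. Otherwise \<open>N(C) \<le> 2n - 2\<close>: at most \<open>n - 1\<close> arcs along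
  undirected edges make \<open>C\<close> strongly connected together with the directed edges, every
  non-constant column is separated by one of these arcs, and every arc separates at most two columns.
  Hence the deficit \<open>7n - 3(N(C) + 1)\<close> is non-negative, and it is at most \<open>2\<close> only for cliques with
  \<open>3\<close>, \<open>4\<close> or \<open>5\<close> elements and \<open>N(C) = 2n\<close>, where it equals \<open>n - 3\<close>. A stack of such blocks
  shows that the deficits of an extremal matrix add up to at most \<open>m mod 3\<close>.\<close>

section \<open>Families of sets\<close>

text \<open>Set version of \<open>cols01\<close>: on column supports these are the columns with 0 in
  row \<open>i\<close> and 1 in row \<open>j\<close>. Emptiness means that every set containing
  \<open>j\<close> contains \<open>i\<close>, which is the directed edge from \<open>i\<close> to
  \<open>j\<close>.\<close>

definition separating :: "'a set set \<Rightarrow> 'a \<Rightarrow> 'a \<Rightarrow> 'a set set" where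
  "separating F i j = {S \<in> F. i \<notin> S \<and> j \<in> S}"

definition splitting :: "'a set set \<Rightarrow> 'a set \<Rightarrow> 'a set set" where
  "splitting F C = {S \<in> F. S \<inter> C \<noteq> {} \<and> \<not> C \<subseteq> S}"

text \<open>With k = a + 1 and n - k = b + 1 the product exceeds n - 1 by exactly a * b.\<close>

lemma mult_diff_ge:
  fixes k n :: nat
  assumes "0 < k" "k < n"
  shows "n - 1 \<le> k * (n - k)" and "k * (n - k) = n - 1 \<Longrightarrow> k = 1 \<or> k = n - 1"
proof -
  obtain a b where ab: "k = Suc a" "n - k = Suc b"
    using assms by (metis Suc_pred zero_less_diff)
  then have n: "n = a + b + 2" using assms by linarith
  show "n - 1 \<le> k * (n - k)" unfolding ab n by simp
  show "k * (n - k) = n - 1 \<Longrightarrow> k = 1 \<or> k = n - 1" unfolding ab n by simp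
qed

text \<open>The assumption \<open>avoid\<close> is the avoidance of F(0,3,1,0) read on column
  supports: a single set with \<open>i\<close> and without \<open>j\<close> rules out three sets
  with \<open>j\<close> and without \<open>i\<close>.\<close>

locale avoiding_family =
  fixes R :: "'a set" and F :: "'a set set"
  assumes finite_R: "finite R"
    and F_subset: "F \<subseteq> Pow R"
    and avoid: "\<lbrakk>i \<in> R; j \<in> R; i \<noteq> j; separating F j i \<noteq> {}\<rbrakk> \<Longrightarrow> card (separating F i j) \<le> 2"
begin

section \<open>The undirected edges and their components\<close>

definition E :: "('a \<times> 'a) set" where
  "E = {(i, j). i \<in> R \<and> j \<in> R \<and> i \<noteq> j \<and> card (separating F i j) < 3 \<and> card (separating F j i) < 3 \<and>
     separating F i j \<noteq> {} \<and> separating F j i \<noteq> {}}"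

definition comps :: "'a set set" where
  "comps = R // E\<^sup>*"

lemma finite_F: "finite F"
  using finite_R F_subset finite_subset by blast

lemma finite_separating [simp]: "finite (separating F i j)"
  using finite_F by (simp add: separating_def)

lemma finite_splitting [simp]: "finite (splitting F C)"
  using finite_F by (simp add: splitting_def)

lemma E_sym: "(i, j) \<in> E \<Longrightarrow> (j, i) \<in> E"
  by (auto simp: E_def)

lemma sym_rtrancl_E: "sym (E\<^sup>*)"
  using E_sym by (metis symI sym_rtrancl)

lemma E_or_directed:
  "\<lbrakk>i \<in> R; j \<in> R; i \<noteq> j\<rbrakk> \<Longrightarrow> (i, j) \<in> E \<or> separating F i j = {} \<or> separating F j i = {}"
  using avoid[of i j] avoid[of j i] by (auto simp: E_def less_Suc_eq_le numeral_3_eq_3 numeral_2_eq_2)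

lemma E_R: "(i, j) \<in> E\<^sup>* \<Longrightarrow> i \<in> R \<Longrightarrow> j \<in> R"
  by (induction rule: rtrancl_induct) (auto simp: E_def)

text \<open>\<open>E\<^sup>*\<close> is reflexive on the whole type. Cutting it down to
  \<open>R\<close> keeps the classes of the elements of \<open>R\<close> and gives an equivalence
  relation on \<open>R\<close>, to which the facts about quotients apply.\<close>

lemma comps_eq: "comps = R // (E\<^sup>* \<inter> R \<times> R)"
proof -
  have "E\<^sup>* `` {x} = (E\<^sup>* \<inter> R \<times> R) `` {x}" if "x \<in> R" for x
    using that E_R by auto
  then show ?thesis unfolding comps_def quotient_def by simp
qed

lemma equiv_comps: "equiv R (E\<^sup>* \<inter> R \<times> R)"
  by (rule equivI) (use sym_rtrancl_E in \<open>auto simp: refl_on_def sym_def trans_def intro: rtrancl_trans\<close>)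

lemma comps_subset: "C \<in> comps \<Longrightarrow> C \<subseteq> R"
  using equiv_comps comps_eq in_quotient_imp_subset by metis

lemma comps_nonempty: "C \<in> comps \<Longrightarrow> C \<noteq> {}"
  using equiv_comps comps_eq in_quotient_imp_non_empty by metis

lemma comps_disjoint: "\<lbrakk>C \<in> comps; D \<in> comps; C \<noteq> D\<rbrakk> \<Longrightarrow> C \<inter> D = {}"
  using equiv_comps comps_eq quotient_disj by metis

lemma Union_comps: "\<Union> comps = R"
  using equiv_comps comps_eq Union_quotient by metis

lemma comp_exists: "x \<in> R \<Longrightarrow> \<exists>C\<in>comps. x \<in> C"
  by (rule UnionE[of x comps]) (auto simp: Union_comps)

lemma finite_comps: "finite comps"
  using Union_comps finite_R finite_UnionD by metis

lemma finite_comp: "C \<in> comps \<Longrightarrow> finite C"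
  using comps_subset finite_R finite_subset by metis

lemma sum_card_comps: "(\<Sum>C\<in>comps. card C) = card R"
  using card_Union_disjoint[of comps] comps_disjoint finite_comp
  by (auto simp: Union_comps pairwise_def disjnt_def)

lemma comp_connected: "\<lbrakk>C \<in> comps; i \<in> C; j \<in> C\<rbrakk> \<Longrightarrow> (i, j) \<in> E\<^sup>*"
  using comps_eq quotient_eq_iff[OF equiv_comps, of C C i j] by auto

lemma comp_closed: "\<lbrakk>C \<in> comps; i \<in> C; (i, j) \<in> E\<^sup>*\<rbrakk> \<Longrightarrow> j \<in> C"
  using comps_eq in_quotient_imp_closed[OF equiv_comps, of C i j] comps_subset[of C] E_R[of i j] by blast

section \<open>Components that are not cliques\<close>

lemma finite_subset_comp: "\<lbrakk>C \<in> comps; W \<subseteq> C\<rbrakk> \<Longrightarrow> finite W"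
  using finite_comp finite_subset by metis

text \<open>\<open>rigid W\<close>: adding fewer than \<open>card W\<close> arcs of \<open>E\<close> to the arcs forced by the
  directed edges makes \<open>W\<close> strongly connected.\<close>

definition rigid :: "'a set \<Rightarrow> bool" where
  "rigid W \<longleftrightarrow> (\<exists>D \<subseteq> E \<inter> W \<times> W. card D < card W \<and>
     (\<forall>S\<in>F. (\<forall>(i, j)\<in>D. i \<in> S \<longrightarrow> j \<in> S) \<longrightarrow> W \<subseteq> S \<or> W \<inter> S = {}))"

text \<open>The new element may cost one arc. If some u in \<open>W\<close> is not joined to
  \<open>v\<close> by an edge, the directed edge between them gives one direction for free and an
  arc between \<open>v\<close> and \<open>w\<close> gives the other. If \<open>v\<close> is adjacent
  to all of \<open>W\<close>, an arc inside \<open>W\<close> is rerouted through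
  \<open>v\<close>.\<close>

lemma rigid_insert:
  assumes W: "rigid W" "finite W" "W \<subseteq> R" "2 \<le> card W"
    and v: "v \<notin> W" "w \<in> W" "(v, w) \<in> E"
  shows "rigid (insert v W)"
proof -
  obtain D where D: "D \<subseteq> E \<inter> W \<times> W" "card D < card W"
    and closed: "\<forall>S\<in>F. (\<forall>(i, j)\<in>D. i \<in> S \<longrightarrow> j \<in> S) \<longrightarrow> W \<subseteq> S \<or> W \<inter> S = {}"
    using W(1) unfolding rigid_def by (elim exE conjE)
  have cl: "W \<subseteq> S \<or> W \<inter> S = {}" if "S \<in> F" "\<forall>(i, j)\<in>D. i \<in> S \<longrightarrow> j \<in> S" for S
    using closed that by simp
  have finD: "finite D" using D(1) W(2) by (meson finite_SigmaI finite_subset le_inf_iff)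
  have card_iW: "card (insert v W) = Suc (card W)" using v(1) W(2) by simp
  have card_ins: "card (insert x D) < card (insert v W)" for x
    using card_insert_le_m1[of "Suc (card D)" D x] D(2) card_iW finD by (simp add: card_insert_if)
  have vR: "v \<in> R" using v(3) by (auto simp: E_def)
  show ?thesis
  proof (cases "\<exists>u\<in>W. (u, v) \<notin> E")
    case True
    then obtain u where u: "u \<in> W" "(u, v) \<notin> E" by blast
    then have "separating F u v = {} \<or> separating F v u = {}"
      using E_or_directed[of u v] vR W(3) v(1) by auto
    then consider (a) "\<And>S. S \<in> F \<Longrightarrow> v \<in> S \<Longrightarrow> u \<in> S" | (b) "\<And>S. S \<in> F \<Longrightarrow> u \<in> S \<Longrightarrow> v \<in> S"
      by (auto simp: separating_def)
    then show ?thesis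
    proof cases
      case a
      show ?thesis unfolding rigid_def
      proof (intro exI[of _ "insert (w, v) D"] conjI ballI impI)
        show "insert (w, v) D \<subseteq> E \<inter> insert v W \<times> insert v W"
          using D(1) v E_sym by auto
        show "card (insert (w, v) D) < card (insert v W)" by (rule card_ins)
        fix S assume S: "S \<in> F" "\<forall>(i, j)\<in>insert (w, v) D. i \<in> S \<longrightarrow> j \<in> S"
        have "W \<subseteq> S \<or> W \<inter> S = {}" by (rule cl[OF S(1)]) (use S(2) in simp)
        then show "insert v W \<subseteq> S \<or> insert v W \<inter> S = {}"
          using S a[OF S(1)] u v by auto
      qed
    next
      case b
      show ?thesis unfolding rigid_def
      proof (intro exI[of _ "insert (v, w) D"] conjI ballI impI)
        show "insert (v, w) D \<subseteq> E \<inter> insert v W \<times> insert v W"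
          using D(1) v E_sym by auto
        show "card (insert (v, w) D) < card (insert v W)" by (rule card_ins)
        fix S assume S: "S \<in> F" "\<forall>(i, j)\<in>insert (v, w) D. i \<in> S \<longrightarrow> j \<in> S"
        have "W \<subseteq> S \<or> W \<inter> S = {}" by (rule cl[OF S(1)]) (use S(2) in simp)
        then show "insert v W \<subseteq> S \<or> insert v W \<inter> S = {}"
          using S b[OF S(1)] u v by auto
      qed
    qed
  next
    case False
    then have all: "(u, v) \<in> E" "(v, u) \<in> E" if "u \<in> W" for u using that E_sym by blast+
    show ?thesis
    proof (cases "D = {}")
      case True
      \<comment> \<open>With \<open>D\<close> empty every set of \<open>F\<close> is already
        constant on \<open>W\<close>, so linking \<open>v\<close> to \<open>w\<close> in both
        directions is enough. The two arcs are affordable because \<open>W\<close> has at least two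
        elements.\<close>
      show ?thesis unfolding rigid_def
      proof (intro exI[of _ "{(v, w), (w, v)}"] conjI ballI impI)
        show "{(v, w), (w, v)} \<subseteq> E \<inter> insert v W \<times> insert v W"
          using v E_sym by auto
        have "card {(v, w), (w, v)} \<le> 2" using card_insert_le_m1[of 2 "{(w, v)}"] by simp
        then show "card {(v, w), (w, v)} < card (insert v W)" using W(4) card_iW by linarith
        fix S assume S: "S \<in> F" "\<forall>(i, j)\<in>{(v, w), (w, v)}. i \<in> S \<longrightarrow> j \<in> S"
        have "W \<subseteq> S \<or> W \<inter> S = {}" by (rule cl[OF S(1)]) (use True in simp)
        then show "insert v W \<subseteq> S \<or> insert v W \<inter> S = {}"
          using S v by auto
      qed
    next
      case False
      then obtain a b where ab: "(a, b) \<in> D" by auto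
      then have abW: "a \<in> W" "b \<in> W" using D(1) by auto
      \<comment> \<open>Subdividing the arc \<open>(a, b)\<close> at \<open>v\<close> costs only one further arc.\<close>
      let ?D = "insert (a, v) (insert (v, b) (D - {(a, b)}))"
      show ?thesis unfolding rigid_def
      proof (intro exI[of _ ?D] conjI ballI impI)
        show "?D \<subseteq> E \<inter> insert v W \<times> insert v W"
          using D(1) all abW by auto
        have "card (D - {(a, b)}) < card D" by (rule card_Diff1_less[OF finD ab])
        moreover have "card ?D \<le> Suc (Suc (card (D - {(a, b)})))"
          using finD by (simp add: card_insert_if)
        ultimately show "card ?D < card (insert v W)" using D(2) card_iW by linarith
        fix S assume S: "S \<in> F" "\<forall>(i, j)\<in>?D. i \<in> S \<longrightarrow> j \<in> S"
        have av: "a \<in> S \<Longrightarrow> v \<in> S" "v \<in> S \<Longrightarrow> b \<in> S" using S(2) by auto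
        have "\<forall>(i, j)\<in>D. i \<in> S \<longrightarrow> j \<in> S" using S(2) av by fastforce
        then have "W \<subseteq> S \<or> W \<inter> S = {}" by (rule cl[OF S(1)])
        then show "insert v W \<subseteq> S \<or> insert v W \<inter> S = {}"
          using av abW by auto
      qed
    qed
  qed
qed

text \<open>Every set containing \<open>x\<close> contains \<open>y\<close>, and the arcs from
  \<open>y\<close> to \<open>v\<close> and from \<open>v\<close> to \<open>x\<close> close the
  directed cycle. This is the seed from which a component that is not a clique is grown.\<close>

lemma rigid_path:
  assumes "(x, v) \<in> E" "(v, y) \<in> E" "x \<noteq> y" "separating F y x = {}"
  shows "rigid {x, v, y}"
  unfolding rigid_def
proof (intro exI[of _ "{(y, v), (v, x)}"] conjI ballI impI)
  show "{(y, v), (v, x)} \<subseteq> E \<inter> {x, v, y} \<times> {x, v, y}" using assms E_sym by auto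
  have "x \<noteq> v" "v \<noteq> y" using assms by (auto simp: E_def)
  then show "card {(y, v), (v, x)} < card {x, v, y}" using assms(3) by simp
  fix S assume "S \<in> F" "\<forall>(i, j)\<in>{(y, v), (v, x)}. i \<in> S \<longrightarrow> j \<in> S"
  then show "{x, v, y} \<subseteq> S \<or> {x, v, y} \<inter> S = {}"
    using assms(4) by (auto simp: separating_def)
qed

lemma comp_extend:
  assumes C: "C \<in> comps" and W: "W \<subseteq> C" "W \<noteq> {}" "W \<noteq> C"
  shows "\<exists>v\<in>C - W. \<exists>w\<in>W. (v, w) \<in> E"
proof (rule ccontr)
  assume not: "\<not> ?thesis"
  obtain i j where i: "i \<in> W" and j: "j \<in> C - W" using W by blast
  have ij: "(i, j) \<in> E\<^sup>*" using comp_connected C i j W by blast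
  have "k \<in> W" if "(i, k) \<in> E\<^sup>*" for k
    using that
  proof (induction rule: rtrancl_induct)
    case base
    then show ?case by (rule i)
  next
    case (step y z)
    then have "z \<in> C" using comp_closed[OF C, of y z] W(1) by auto
    then show ?case using not step E_sym by blast
  qed
  then show False using ij j by blast
qed

text \<open>Induction on the number of elements of \<open>C\<close> missing from \<open>W\<close>:
  connectivity supplies a neighbour outside \<open>W\<close>, which \<open>rigid_insert\<close>
  absorbs.\<close>

lemma rigid_comp:
  assumes C: "C \<in> comps" and W: "rigid W" "W \<subseteq> C" "2 \<le> card W"
  shows "rigid C"
  using W
proof (induction "card C - card W" arbitrary: W rule: less_induct)
  case less
  show ?case
  proof (cases "W = C")
    case True
    then show ?thesis using less by simp
  next
    case False
    have fin: "finite W" using finite_subset_comp[OF C less.prems(2)] .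
    obtain v w where v: "v \<in> C - W" "w \<in> W" "(v, w) \<in> E"
      using comp_extend[OF C less.prems(2) _ False] less.prems(3) by fastforce
    have "rigid (insert v W)"
      using rigid_insert[OF less.prems(1) fin _ less.prems(3), of v w] v comps_subset[OF C] less.prems(2)
      by blast
    moreover have "card (insert v W) \<le> card C"
      using v less.prems(2) finite_comp[OF C] by (intro card_mono) auto
    moreover have "card (insert v W) = Suc (card W)" using v fin by simp
    ultimately show ?thesis using less.hyps[of "insert v W"] v less.prems by auto
  qed
qed

text \<open>A set that splits \<open>C\<close> violates some arc (i, j) of \<open>D\<close>,
  containing i but not j. Each arc is an edge and so accounts for at most two sets, and there are at
  most \<open>card C - 1\<close> arcs.\<close>

lemma card_splitting_rigid:
  assumes "rigid C" "finite C"
  shows "card (splitting F C) + 2 \<le> 2 * card C"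
proof -
  obtain D where D: "D \<subseteq> E \<inter> C \<times> C" "card D < card C"
    and closed: "\<forall>S\<in>F. (\<forall>(i, j)\<in>D. i \<in> S \<longrightarrow> j \<in> S) \<longrightarrow> C \<subseteq> S \<or> C \<inter> S = {}"
    using assms(1) unfolding rigid_def by (elim exE conjE)
  have cl: "C \<subseteq> S \<or> C \<inter> S = {}" if "S \<in> F" "\<forall>(i, j)\<in>D. i \<in> S \<longrightarrow> j \<in> S" for S
    using closed that by simp
  have finD: "finite D" using D(1) assms(2) by (meson finite_SigmaI finite_subset le_inf_iff)
  have "splitting F C \<subseteq> (\<Union>(i, j)\<in>D. separating F j i)"
    using cl by (fastforce simp: splitting_def separating_def)
  then have "card (splitting F C) \<le> card (\<Union>(i, j)\<in>D. separating F j i)"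
    using finD by (intro card_mono) auto
  also have "\<dots> \<le> (\<Sum>(i, j)\<in>D. card (separating F j i))"
    using card_UN_le[OF finD, of "\<lambda>(i, j). separating F j i"] by (simp add: case_prod_unfold)
  also have "\<dots> \<le> (\<Sum>(i, j)\<in>D. 2)"
    using D(1) by (intro sum_mono) (auto simp: E_def)
  finally show ?thesis using D(2) by (simp add: case_prod_unfold)
qed

lemma card_splitting_nonclique:
  assumes C: "C \<in> comps" and ij: "i \<in> C" "j \<in> C" "i \<noteq> j" "(i, j) \<notin> E"
  shows "card (splitting F C) + 2 \<le> 2 * card C"
proof -
  \<comment> \<open>If the ends of every path with two edges coincided or were adjacent, every
    element reachable from \<open>i\<close> would be \<open>i\<close> or a neighbour of it, and
    \<open>j\<close> is neither. The missing edge between x and y is then a directed one, as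
    \<open>rigid_path\<close> requires.\<close>
  have "\<exists>x v y. (x, v) \<in> E \<and> (v, y) \<in> E \<and> x \<noteq> y \<and> (x, y) \<notin> E \<and> x \<in> C"
  proof (rule ccontr)
    assume not: "\<not> ?thesis"
    have "k = i \<or> (i, k) \<in> E" if "(i, k) \<in> E\<^sup>*" for k
      using that by (induction rule: rtrancl_induct) (use not ij in blast)+
    then show False using comp_connected[OF C ij(1,2)] ij by blast
  qed
  then obtain x v y where xvy: "(x, v) \<in> E" "(v, y) \<in> E" "x \<noteq> y" "(x, y) \<notin> E" "x \<in> C" by blast
  have "v \<in> C" "y \<in> C" using comp_closed[OF C xvy(5)] xvy by (meson r_into_rtrancl rtrancl.rtrancl_into_rtrancl)+
  have "separating F x y = {} \<or> separating F y x = {}"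
    using E_or_directed[of x y] xvy by (auto simp: E_def)
  then have "rigid {x, v, y}"
    using rigid_path[of x v y] rigid_path[of y v x] xvy E_sym by (auto simp: insert_commute)
  moreover have "2 \<le> card {x, v, y}" using xvy(3) by (auto simp: card_insert_if)
  ultimately have "rigid C" using rigid_comp[OF C] xvy \<open>v \<in> C\<close> \<open>y \<in> C\<close> by auto
  then show ?thesis using card_splitting_rigid finite_comp[OF C] by blast
qed

section \<open>Double counting in cliques\<close>

lemma card_splitting_clique:
  assumes C: "C \<subseteq> R" "2 \<le> card C" and cl: "\<And>i j. \<lbrakk>i \<in> C; j \<in> C; i \<noteq> j\<rbrakk> \<Longrightarrow> (i, j) \<in> E"
  shows "card (splitting F C) \<le> 2 * card C"
    and "card (splitting F C) = 2 * card C \<Longrightarrow> S \<in> splitting F C \<Longrightarrow>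
      card (S \<inter> C) = 1 \<or> card (S \<inter> C) = card C - 1"
proof -
  let ?n = "card C" and ?N = "splitting F C"
  have finC: "finite C" using C finite_R finite_subset by blast
  have cross: "card (S \<inter> C) * (?n - card (S \<inter> C)) = card {p \<in> C \<times> C. fst p \<in> S \<and> snd p \<notin> S}" for S
  proof -
    have "{p \<in> C \<times> C. fst p \<in> S \<and> snd p \<notin> S} = (S \<inter> C) \<times> (C - S \<inter> C)" by auto
    then show ?thesis using finC by (simp add: card_cartesian_product card_Diff_subset)
  qed
  have "(\<Sum>S\<in>?N. card (S \<inter> C) * (?n - card (S \<inter> C))) =
      (\<Sum>S\<in>?N. card {p \<in> C \<times> C. fst p \<in> S \<and> snd p \<notin> S})" by (simp add: cross)
  also have "\<dots> = (\<Sum>p\<in>C\<times>C. card {S\<in>?N. fst p \<in> S \<and> snd p \<notin> S})"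
    using finC by (intro sum_multicount_gen) auto
  \<comment> \<open>Two distinct elements of the clique are joined by an edge, so at most two sets
    contain the first and miss the second. Pairs on the diagonal contribute nothing.\<close>
  also have "\<dots> \<le> (\<Sum>p\<in>C\<times>C. if fst p = snd p then 0 else 2)"
  proof (intro sum_mono)
    fix p assume p: "p \<in> C \<times> C"
    show "card {S\<in>?N. fst p \<in> S \<and> snd p \<notin> S} \<le> (if fst p = snd p then 0 else 2)"
    proof (cases "fst p = snd p")
      case True
      then show ?thesis by auto
    next
      case False
      have "card {S\<in>?N. fst p \<in> S \<and> snd p \<notin> S} \<le> card (separating F (snd p) (fst p))"
        by (intro card_mono finite_separating) (auto simp: splitting_def separating_def)
      also have "\<dots> \<le> 2" using cl[of "snd p" "fst p"] p False by (auto simp: E_def)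
      finally show ?thesis using False by simp
    qed
  qed
  also have "\<dots> = 2 * (?n * (?n - 1))"
  proof -
    have "(\<Sum>p\<in>C\<times>C. if fst p = snd p then 0 else 2::nat) = (\<Sum>i\<in>C. \<Sum>j\<in>C. if i = j then 0 else 2)"
      by (simp add: sum.cartesian_product case_prod_unfold)
    also have "\<dots> = (\<Sum>i\<in>C. \<Sum>j\<in>C - {i}. 2)"
      using finC by (intro sum.cong refl sum.mono_neutral_cong_right) auto
    finally show ?thesis using finC by (simp add: card_Diff_singleton)
  qed
  finally have up: "(\<Sum>S\<in>?N. card (S \<inter> C) * (?n - card (S \<inter> C))) \<le> 2 * (?n * (?n - 1))" .
  have k: "0 < card (S \<inter> C)" "card (S \<inter> C) < ?n" if "S \<in> ?N" for S
    using that finC by (auto simp: splitting_def card_gt_0_iff intro!: psubset_card_mono)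
  note low = mult_diff_ge(1)[OF k]
  have "card ?N * (?n - 1) \<le> (\<Sum>S\<in>?N. card (S \<inter> C) * (?n - card (S \<inter> C)))"
    using low sum_mono[of ?N "\<lambda>_. ?n - 1"] by simp
  then have "card ?N * (?n - 1) \<le> (2 * ?n) * (?n - 1)"
    using up unfolding mult.assoc by (rule order_trans)
  then show "card ?N \<le> 2 * ?n" using C(2) unfolding mult_le_cancel2 by auto
  assume eq: "card ?N = 2 * ?n" and S: "S \<in> ?N"
  \<comment> \<open>With \<open>2 * ?n\<close> sets the upper bound equals the sum of the lower
    bounds \<open>?n - 1\<close>, so every summand attains its lower bound.\<close>
  have "(\<Sum>S\<in>?N. card (S \<inter> C) * (?n - card (S \<inter> C))) \<le> (\<Sum>S\<in>?N. ?n - 1)"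
    using up eq by simp
  then have "card (S \<inter> C) * (?n - card (S \<inter> C)) = ?n - 1"
    using sum_mono_inv[of "\<lambda>_. ?n - 1" ?N "\<lambda>S. card (S \<inter> C) * (?n - card (S \<inter> C))" S] low S
      sum_mono[of ?N "\<lambda>_. ?n - 1" "\<lambda>S. card (S \<inter> C) * (?n - card (S \<inter> C))"]
    by (simp add: antisym)
  then show "card (S \<inter> C) = 1 \<or> card (S \<inter> C) = card C - 1"
    using mult_diff_ge(2)[OF k[OF S]] by blast
qed

section \<open>The order of the components\<close>

lemma comps_ordered:
  assumes C: "C \<in> comps" and D: "D \<in> comps" and ne: "C \<noteq> D"
  shows "(\<forall>S\<in>F. S \<inter> D \<noteq> {} \<longrightarrow> C \<subseteq> S) \<or> (\<forall>S\<in>F. S \<inter> C \<noteq> {} \<longrightarrow> D \<subseteq> S)"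
proof -
  have noE: "(c, d) \<notin> E" if "c \<in> C" "d \<in> D" for c d
    using comp_closed[OF C that(1)] comps_disjoint[OF C D ne] that by blast
  have dich: "separating F c d = {} \<or> separating F d c = {}" if "c \<in> C" "d \<in> D" for c d
    using E_or_directed[of c d] noE[OF that] that comps_subset[OF C] comps_subset[OF D]
      comps_disjoint[OF C D ne] by blast
  have sep: "separating F c d = {} \<longleftrightarrow> (\<forall>S\<in>F. d \<in> S \<longrightarrow> c \<in> S)" for c d
    by (auto simp: separating_def)
  \<comment> \<open>The direction is inherited along an edge: were it reversed between
    \<open>c'\<close> and \<open>d\<close>, every set containing \<open>c'\<close> would contain
    \<open>d\<close> and hence \<open>c\<close>, contrary to the edge. \<open>step2\<close> is the
    same argument in the other component.\<close>
  have step1: "separating F c' d = {}" if "separating F c d = {}" "(c, c') \<in> E" "c' \<in> C" "d \<in> D" for c c' d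
  proof (rule ccontr)
    assume "separating F c' d \<noteq> {}"
    then have "separating F d c' = {}" using dich that by blast
    then have "separating F c c' = {}" using that(1) unfolding sep by blast
    then show False using that(2) by (simp add: E_def)
  qed
  have step2: "separating F c d' = {}" if "separating F c d = {}" "(d, d') \<in> E" "c \<in> C" "d' \<in> D" for c d d'
  proof (rule ccontr)
    assume "separating F c d' \<noteq> {}"
    then have "separating F d' c = {}" using dich that by blast
    then have "separating F d' d = {}" using that(1) unfolding sep by blast
    then show False using that(2) by (simp add: E_def)
  qed
  show ?thesis
  proof (cases "\<exists>c\<in>C. \<exists>d\<in>D. separating F c d = {}")
    case True
    then obtain c d where cd: "c \<in> C" "d \<in> D" "separating F c d = {}" by blast
    have 1: "separating F c' d = {}" if "c' \<in> C" for c'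
    proof -
      have "(c, c') \<in> E\<^sup>*" using comp_connected[OF C cd(1) that] .
      then show ?thesis
      proof (induction rule: rtrancl_induct)
        case base
        then show ?case by (rule cd(3))
      next
        case (step y z)
        then show ?case using step1[of y d z] comp_closed[OF C cd(1), of z] cd(2)
          by (meson rtrancl.rtrancl_into_rtrancl)
      qed
    qed
    have 2: "separating F c' d' = {}" if "c' \<in> C" "d' \<in> D" for c' d'
    proof -
      have "(d, d') \<in> E\<^sup>*" using comp_connected[OF D cd(2) that(2)] .
      then show ?thesis
      proof (induction rule: rtrancl_induct)
        case base
        then show ?case using 1[OF that(1)] .
      next
        case (step y z)
        then show ?case using step2[of c' y z] comp_closed[OF D cd(2), of z] that(1)
          by (meson rtrancl.rtrancl_into_rtrancl)
      qed
    qed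
    then show ?thesis unfolding sep by blast
  next
    case False
    then have "separating F d c = {}" if "c \<in> C" "d \<in> D" for c d using dich that by blast
    then show ?thesis unfolding sep by blast
  qed
qed

text \<open>A set that splits \<open>C\<close> contains or misses each other component as a whole,
  and \<open>comps_ordered\<close> fixes which of the two happens independently of the set. Only the
  trace on \<open>C\<close> is left free.\<close>

lemma inj_on_trace:
  assumes C: "C \<in> comps"
  shows "inj_on (\<lambda>S. S \<inter> C) (splitting F C)"
proof (rule inj_onI)
  fix S S' assume S: "S \<in> splitting F C" and S': "S' \<in> splitting F C" and eq: "S \<inter> C = S' \<inter> C"
  have "x \<in> S \<longleftrightarrow> x \<in> S'" if "x \<in> R" for x
  proof -
    obtain D where D: "D \<in> comps" "x \<in> D" using comp_exists[OF \<open>x \<in> R\<close>] by blast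
    show ?thesis
    proof (cases "D = C")
      case True
      then show ?thesis using eq D(2) by blast
    next
      case False
      have "S \<in> F" "S' \<in> F" "S \<inter> C \<noteq> {}" "S' \<inter> C \<noteq> {}" "\<not> C \<subseteq> S" "\<not> C \<subseteq> S'"
        using S S' by (simp_all add: splitting_def)
      then have "(S \<inter> D = {} \<and> S' \<inter> D = {}) \<or> (D \<subseteq> S \<and> D \<subseteq> S')"
        using comps_ordered[OF C D(1)] False by metis
      then show ?thesis using D(2) by blast
    qed
  qed
  then show "S = S'" using F_subset S S' unfolding splitting_def by blast
qed

text \<open>At most \<open>2 * card C\<close> subsets have one of the two sizes, and the splitting
  sets provide that many different traces of these sizes. Hence every such subset occurs.\<close>

lemma splitting_traces:
  assumes C: "C \<in> comps" "2 \<le> card C" and cl: "\<And>i j. \<lbrakk>i \<in> C; j \<in> C; i \<noteq> j\<rbrakk> \<Longrightarrow> (i, j) \<in> E"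
    and eq: "card (splitting F C) = 2 * card C"
  shows "(\<lambda>S. S \<inter> C) ` splitting F C = {T. T \<subseteq> C \<and> (card T = 1 \<or> card T = card C - 1)}"
proof (rule card_seteq)
  let ?U = "(\<lambda>x. {x}) ` C \<union> (\<lambda>x. C - {x}) ` C"
  have finC: "finite C" using finite_comp C by blast
  have U: "{T. T \<subseteq> C \<and> (card T = 1 \<or> card T = card C - 1)} \<subseteq> ?U"
  proof
    fix T assume T: "T \<in> {T. T \<subseteq> C \<and> (card T = 1 \<or> card T = card C - 1)}"
    then consider "card T = 1" | "card T = card C - 1" by blast
    then show "T \<in> ?U"
    proof cases
      case 1
      then show ?thesis using T by (auto simp: card_1_singleton_iff)
    next
      case 2
      then have "card (C - T) = 1" using T finC C(2) by (simp add: card_Diff_subset finite_subset)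
      then obtain x where "C - T = {x}" by (auto simp: card_1_singleton_iff)
      then have "T = C - {x}" "x \<in> C" using T by auto
      then show ?thesis by blast
    qed
  qed
  show "finite {T. T \<subseteq> C \<and> (card T = 1 \<or> card T = card C - 1)}" using finC by simp
  show "(\<lambda>S. S \<inter> C) ` splitting F C \<subseteq> {T. T \<subseteq> C \<and> (card T = 1 \<or> card T = card C - 1)}"
    using card_splitting_clique(2)[OF comps_subset[OF C(1)] C(2) cl eq] by auto
  have "card {T. T \<subseteq> C \<and> (card T = 1 \<or> card T = card C - 1)} \<le> card ?U"
    using U finC by (intro card_mono) auto
  also have "\<dots> \<le> card C + card C"
    using finC by (intro order_trans[OF card_Un_le] add_mono card_image_le)
  finally show "card {T. T \<subseteq> C \<and> (card T = 1 \<or> card T = card C - 1)} \<le> card ((\<lambda>S. S \<inter> C) ` splitting F C)"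
    using card_image[OF inj_on_trace[OF C(1)]] eq by simp
qed

section \<open>Counting the whole family\<close>

lemma card_constant_le:
  "card {S \<in> F. \<forall>C\<in>comps. S \<notin> splitting F C} \<le> card comps + of_bool ({} \<in> F)"
proof -
  let ?K = "{S \<in> F. \<forall>C\<in>comps. S \<notin> splitting F C}"
  define h where "h S = {C \<in> comps. C \<subseteq> S}" for S
  have const: "C \<subseteq> S \<or> S \<inter> C = {}" if "S \<in> ?K" "C \<in> comps" for S C
    using that by (auto simp: splitting_def)
  have h_Union: "S = \<Union> (h S)" if S: "S \<in> ?K" for S
  proof
    show "S \<subseteq> \<Union> (h S)"
    proof
      fix x assume x: "x \<in> S"
      then have "x \<in> R" using S F_subset by blast
      then obtain C where "C \<in> comps" "x \<in> C" using comp_exists by blast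
      then show "x \<in> \<Union> (h S)" using const[OF S] x by (auto simp: h_def)
    qed
  qed (auto simp: h_def)
  \<comment> \<open>If neither set contained the other, each would contain a component that the
    other misses, against the order of these two components.\<close>
  have chain: "S \<subseteq> T \<or> T \<subseteq> S" if S: "S \<in> ?K" and T: "T \<in> ?K" for S T
  proof (rule ccontr)
    assume "\<not> ?thesis"
    then obtain x y where xy: "x \<in> S" "x \<notin> T" "y \<in> T" "y \<notin> S" by blast
    then have "x \<in> R" "y \<in> R" using S T F_subset by blast+
    then obtain C D where CD: "C \<in> comps" "x \<in> C" "D \<in> comps" "y \<in> D" using comp_exists by meson
    have "C \<subseteq> S" "T \<inter> C = {}" "D \<subseteq> T" "S \<inter> D = {}" using const S T CD xy by blast+
    then show False using comps_ordered[OF CD(1,3)] CD xy S T by blast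
  qed
  have inj: "inj_on (\<lambda>S. card (h S)) ?K"
  proof (rule inj_onI)
    fix S T assume S: "S \<in> ?K" and T: "T \<in> ?K" and eq: "card (h S) = card (h T)"
    have "h S \<subseteq> h T \<or> h T \<subseteq> h S" using chain[OF S T] by (auto simp: h_def)
    moreover have "finite (h S)" "finite (h T)" using finite_comps by (auto simp: h_def)
    ultimately have "h S = h T" using eq card_subset_eq by metis
    then show "S = T" using h_Union[OF S] h_Union[OF T] by simp
  qed
  have h_le: "card (h S) \<le> card comps" for S
    using finite_comps by (intro card_mono) (auto simp: h_def)
  have "card ?K = card ((\<lambda>S. card (h S)) ` ?K)" using card_image[OF inj] by simp
  \<comment> \<open>Only the empty set contains no component, so the count starts at 1 when it is
    absent. Keeping track of this later forces the empty set into an extremal family.\<close>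
  also have "\<dots> \<le> card {1 - of_bool ({} \<in> F)..card comps}"
  proof (intro card_mono)
    show "(\<lambda>S. card (h S)) ` ?K \<subseteq> {1 - of_bool ({} \<in> F)..card comps}"
    proof (cases "{} \<in> F")
      case True
      then show ?thesis using h_le by auto
    next
      case False
      have "0 < card (h S)" if "S \<in> ?K" for S
      proof -
        have "h S \<noteq> {}" using h_Union[OF that] that False by auto
        then show ?thesis using finite_comps by (simp add: card_gt_0_iff h_def)
      qed
      then show ?thesis using h_le False by (auto simp: Suc_le_eq)
    qed
  qed simp
  finally show ?thesis by (cases "{} \<in> F") simp_all
qed

lemma card_F_le:
  "card F \<le> (\<Sum>C\<in>comps. card (splitting F C) + 1) + of_bool ({} \<in> F)"
proof -
  let ?K = "{S \<in> F. \<forall>C\<in>comps. S \<notin> splitting F C}"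
  have "F = (\<Union>C\<in>comps. splitting F C) \<union> ?K" by (auto simp: splitting_def)
  then have "card F = card ((\<Union>C\<in>comps. splitting F C) \<union> ?K)" by (rule arg_cong)
  also have "\<dots> \<le> card (\<Union>C\<in>comps. splitting F C) + card ?K" by (rule card_Un_le)
  also have "card (\<Union>C\<in>comps. splitting F C) \<le> (\<Sum>C\<in>comps. card (splitting F C))"
    using finite_comps by (rule card_UN_le)
  finally show ?thesis using card_constant_le unfolding sum.distrib card_eq_sum[of comps] by linarith
qed

text \<open>Let n be the size of \<open>C\<close>. If \<open>C\<close> is not a clique, the deficit
  is at least n + 3. For a clique with n at least 3 it is n - 3 if \<open>2 * n\<close> sets split
  it and at least n otherwise. For n at most 2 there are at most \<open>2 ^ n - 2\<close> traces,
  and the deficit is at least 4.\<close>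

lemma deficit:
  assumes C: "C \<in> comps"
  defines "e \<equiv> 7 * int (card C) - 3 * (int (card (splitting F C)) + 1)"
  shows "0 \<le> e" and "e \<le> 2 \<Longrightarrow> e = int (card C) - 3 \<and> 3 \<le> card C \<and>
      card (splitting F C) = 2 * card C \<and> (\<forall>i\<in>C. \<forall>j\<in>C. i \<noteq> j \<longrightarrow> (i, j) \<in> E)"
proof -
  have finC: "finite C" and "C \<noteq> {}" using finite_comp C comps_nonempty by blast+
  then have pos: "0 < card C" by (simp add: card_gt_0_iff)
  have "0 \<le> e \<and> (e \<le> 2 \<longrightarrow> e = int (card C) - 3 \<and> 3 \<le> card C \<and>
      card (splitting F C) = 2 * card C \<and> (\<forall>i\<in>C. \<forall>j\<in>C. i \<noteq> j \<longrightarrow> (i, j) \<in> E))"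
  proof (cases "\<forall>i\<in>C. \<forall>j\<in>C. i \<noteq> j \<longrightarrow> (i, j) \<in> E")
    case False
    then have "card (splitting F C) + 2 \<le> 2 * card C"
      using card_splitting_nonclique[OF C] by blast
    then have "e \<ge> int (card C) + 3" unfolding e_def by simp
    then show ?thesis using pos by linarith
  next
    case cl: True
    show ?thesis
    proof (cases "card C \<ge> 3")
      case True
      then have "card (splitting F C) \<le> 2 * card C"
        using card_splitting_clique(1)[OF comps_subset[OF C]] cl by auto
      moreover from this True have "e \<le> 2 \<Longrightarrow> card (splitting F C) = 2 * card C"
        unfolding e_def by (simp add: algebra_simps)
      ultimately show ?thesis using True cl unfolding e_def by auto
    next
      case False
      have "(\<lambda>S. S \<inter> C) ` splitting F C \<subseteq> Pow C - {{}, C}" by (auto simp: splitting_def)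
      then have "card ((\<lambda>S. S \<inter> C) ` splitting F C) \<le> card (Pow C - {{}, C})"
        using finC by (intro card_mono) auto
      also have "\<dots> = 2 ^ card C - 2"
        using finC \<open>C \<noteq> {}\<close> by (simp add: card_Diff_subset card_Pow)
      finally have "card (splitting F C) \<le> 2 ^ card C - 2"
        using card_image[OF inj_on_trace[OF C]] by simp
      moreover have "card C = 1 \<or> card C = 2" using False pos by linarith
      ultimately have "e \<ge> 4" unfolding e_def by auto
      then show ?thesis by linarith
    qed
  qed
  then show "0 \<le> e" and "e \<le> 2 \<Longrightarrow> e = int (card C) - 3 \<and> 3 \<le> card C \<and>
      card (splitting F C) = 2 * card C \<and> (\<forall>i\<in>C. \<forall>j\<in>C. i \<noteq> j \<longrightarrow> (i, j) \<in> E)" by blast+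
qed

text \<open>The hypothesis is the lower bound supplied by a stack of blocks, written without
  subtraction. The deficits then add up to at most \<open>card R mod 3\<close>, so each of them is
  at most 2 and \<open>deficit\<close> describes every component.\<close>

lemma large_family_structure:
  assumes large: "7 * card R + 3 \<le> 3 * card F + card R mod 3"
  shows "{} \<in> F"
    and "(\<Sum>C\<in>comps. card C - 3) = card R mod 3"
    and "C \<in> comps \<Longrightarrow> 3 \<le> card C \<and> card (splitting F C) = 2 * card C \<and>
      (\<forall>i\<in>C. \<forall>j\<in>C. i \<noteq> j \<longrightarrow> (i, j) \<in> E)"
proof -
  define e where "e C = 7 * int (card C) - 3 * (int (card (splitting F C)) + 1)" for C
  note def = deficit[folded e_def]
  have sume: "(\<Sum>C\<in>comps. e C) = 7 * int (card R) - 3 * (\<Sum>C\<in>comps. int (card (splitting F C)) + 1)"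
    unfolding e_def sum_subtractf sum_distrib_left[symmetric] sum_card_comps[symmetric] by simp
  have "int (card F) \<le> (\<Sum>C\<in>comps. int (card (splitting F C)) + 1) + of_bool ({} \<in> F)"
    using card_F_le[THEN zle_int[THEN iffD2]] by (simp add: add_ac)
  then have le: "(\<Sum>C\<in>comps. e C) \<le> int (card R mod 3) - 3 + 3 * of_bool ({} \<in> F)"
    using large sume by linarith
  have nonneg: "0 \<le> (\<Sum>C\<in>comps. e C)" using def(1) by (intro sum_nonneg) auto
  \<comment> \<open>Without the empty set the deficits would add up to at most
    \<open>card R mod 3 - 3\<close>, which is negative.\<close>
  show empty: "{} \<in> F"
  proof (rule ccontr)
    assume "{} \<notin> F"
    then show False using le nonneg by simp
  qed
  have le: "(\<Sum>C\<in>comps. e C) \<le> int (card R mod 3)" using le empty by simp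
  have each: "e C \<le> 2" if "C \<in> comps" for C
  proof -
    have "e C \<le> (\<Sum>C\<in>comps. e C)" using def(1) finite_comps that by (intro member_le_sum) auto
    then show ?thesis using le by linarith
  qed
  note str = def(2)[OF _ each]
  show "3 \<le> card C \<and> card (splitting F C) = 2 * card C \<and>
      (\<forall>i\<in>C. \<forall>j\<in>C. i \<noteq> j \<longrightarrow> (i, j) \<in> E)" if "C \<in> comps" for C
    using str[OF that that] by blast
  let ?s = "\<Sum>C\<in>comps. card C - 3"
  have "(\<Sum>C\<in>comps. e C) = int ?s"
    using str by (simp add: of_nat_diff)
  then have "?s \<le> card R mod 3" using le by linarith
  moreover have "card R = ?s + 3 * card comps"
  proof -
    have "card R = (\<Sum>C\<in>comps. card C - 3 + 3)" using str sum_card_comps by simp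
    then show ?thesis by (simp add: sum.distrib)
  qed
  \<comment> \<open>The sum is at most \<open>card R mod 3\<close> and congruent to
    \<open>card R\<close> modulo 3.\<close>
  ultimately show "?s = card R mod 3" by presburger
qed

end

section \<open>Configurations\<close>

lemma bij_betw_pick:
  assumes "finite S"
  shows "bij_betw (pick S) {..<card S} S"
proof -
  have "inj_on (pick S) {..<card S}"
    by (rule linorder_inj_onI) (use pick_mono_le in \<open>fastforce+\<close>)
  moreover have "pick S ` {..<card S} \<subseteq> S" using pick_in_set_le by auto
  ultimately show ?thesis
    using assms by (simp add: bij_betw_def card_image card_subset_eq)
qed

text \<open>Bijections of the index ranges suffice: the identity outside the ranges extends them to
  permutations in the sense of \<open>permutes\<close>.\<close>

lemma perm_equivI:
  assumes dims: "dim_row A = dim_row B" "dim_col A = dim_col B"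
    and f: "bij_betw f {..<dim_row A} {..<dim_row A}" and g: "bij_betw g {..<dim_col A} {..<dim_col A}"
    and eq: "\<And>i j. \<lbrakk>i < dim_row A; j < dim_col A\<rbrakk> \<Longrightarrow> A $$ (i, j) = B $$ (f i, g j)"
  shows "perm_equiv A B"
proof -
  define p where "p i = (if i < dim_row A then f i else i)" for i
  define q where "q i = (if i < dim_col A then g i else i)" for i
  have "p permutes {..<dim_row A}"
    using f bij_betw_cong[of "{..<dim_row A}" p f] by (intro bij_imp_permutes) (auto simp: p_def)
  moreover have "q permutes {..<dim_col A}"
    using g bij_betw_cong[of "{..<dim_col A}" q g] by (intro bij_imp_permutes) (auto simp: q_def)
  moreover have "\<forall>i<dim_row A. \<forall>j<dim_col A. A $$ (i, j) = B $$ (p i, q j)"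
    using eq by (simp add: p_def q_def)
  ultimately show ?thesis unfolding perm_equiv_def using dims by blast
qed

lemma perm_equiv_submatrixI:
  assumes r: "bij_betw r {..<dim_row F} I" "I \<subseteq> {..<dim_row A}"
    and c: "bij_betw c {..<dim_col F} J" "J \<subseteq> {..<dim_col A}"
    and eq: "\<And>i j. \<lbrakk>i < dim_row F; j < dim_col F\<rbrakk> \<Longrightarrow> A $$ (r i, c j) = F $$ (i, j)"
  shows "perm_equiv (submatrix A I J) F"
proof -
  have I: "{i. i < dim_row A \<and> i \<in> I} = I" and J: "{i. i < dim_col A \<and> i \<in> J} = J"
    using r(2) c(2) by auto
  have cI: "card I = dim_row F" "card J = dim_col F"
    using bij_betw_same_card[OF r(1)] bij_betw_same_card[OF c(1)] by auto
  have fin: "finite I" "finite J" using r(2) c(2) finite_subset by blast+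
  have pI: "bij_betw (pick I) {..<dim_row F} I" and pJ: "bij_betw (pick J) {..<dim_col F} J"
    using bij_betw_pick[OF fin(1)] bij_betw_pick[OF fin(2)] cI by simp_all
  show ?thesis
  proof (rule perm_equivI)
    show d: "dim_row (submatrix A I J) = dim_row F" "dim_col (submatrix A I J) = dim_col F"
      by (simp_all add: dim_submatrix I J cI)
    \<comment> \<open>\<open>pick I\<close> lists \<open>I\<close> increasingly, while
      \<open>r\<close> lists it in the order of the rows of \<open>F\<close>. The inverse of
      \<open>r\<close> after \<open>pick I\<close> translates one numbering into the other, and
      likewise for the columns.\<close>
    let ?f = "the_inv_into {..<dim_row F} r \<circ> pick I" and ?g = "the_inv_into {..<dim_col F} c \<circ> pick J"
    have f: "bij_betw ?f {..<dim_row F} {..<dim_row F}"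
      using pI bij_betw_the_inv_into[OF r(1)] by (rule bij_betw_trans)
    have g: "bij_betw ?g {..<dim_col F} {..<dim_col F}"
      using pJ bij_betw_the_inv_into[OF c(1)] by (rule bij_betw_trans)
    show "bij_betw ?f {..<dim_row (submatrix A I J)} {..<dim_row (submatrix A I J)}"
      "bij_betw ?g {..<dim_col (submatrix A I J)} {..<dim_col (submatrix A I J)}"
      using f g d by simp_all
    fix i j assume "i < dim_row (submatrix A I J)" "j < dim_col (submatrix A I J)"
    then have ij: "i < dim_row F" "j < dim_col F" using d by simp_all
    have "r (?f i) = pick I i" "c (?g j) = pick J j"
      using f_the_inv_into_f_bij_betw[OF r(1)] f_the_inv_into_f_bij_betw[OF c(1)]
        bij_betwE[OF pI] bij_betwE[OF pJ] ij by simp_all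
    moreover have "?f i < dim_row F" "?g j < dim_col F"
      using bij_betwE[OF f] bij_betwE[OF g] ij by auto
    ultimately show "submatrix A I J $$ (i, j) = F $$ (?f i, ?g j)"
      using eq[of "?f i" "?g j"] ij by (simp add: submatrix_index I J cI)
  qed
qed

section \<open>Configurations as pairs of injections\<close>

lemma configurationI:
  assumes r: "inj_on r {..<dim_row F}" "r ` {..<dim_row F} \<subseteq> {..<dim_row A}"
    and c: "inj_on c {..<dim_col F}" "c ` {..<dim_col F} \<subseteq> {..<dim_col A}"
    and eq: "\<And>i j. \<lbrakk>i < dim_row F; j < dim_col F\<rbrakk> \<Longrightarrow> A $$ (r i, c j) = F $$ (i, j)"
  shows "F \<prec> A"
  unfolding configuration_def
  using perm_equiv_submatrixI[OF inj_on_imp_bij_betw[OF r(1)] r(2) inj_on_imp_bij_betw[OF c(1)] c(2) eq]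
  by blast

text \<open>The index set of a submatrix may reach beyond the dimension. The first \<open>n\<close>
  values of \<open>pick I\<close> see only its part below \<open>m\<close>.\<close>

lemma inj_on_pick_below:
  assumes "n = card {i. i < m \<and> i \<in> I}"
  shows "inj_on (pick I) {..<n}" and "pick I ` {..<n} \<subseteq> {..<m}"
proof -
  let ?S = "{i. i < m \<and> i \<in> I}"
  have eq: "pick I i = pick ?S i" if "i \<in> {..<n}" for i
    using that assms by (intro pick_reduce_set) auto
  have b: "bij_betw (pick ?S) {..<n} ?S" using bij_betw_pick[of ?S] assms by simp
  then have b: "bij_betw (pick I) {..<n} ?S" using bij_betw_cong[of "{..<n}" "pick I" "pick ?S"] eq by blast
  show "inj_on (pick I) {..<n}" using b by (rule bij_betw_imp_inj_on)
  show "pick I ` {..<n} \<subseteq> {..<m}" using b by (auto simp: bij_betw_def)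
qed

lemma configurationE:
  assumes "F \<prec> A"
  obtains r c where "inj_on r {..<dim_row F}" "r ` {..<dim_row F} \<subseteq> {..<dim_row A}"
    "inj_on c {..<dim_col F}" "c ` {..<dim_col F} \<subseteq> {..<dim_col A}"
    "\<forall>i<dim_row F. \<forall>j<dim_col F. A $$ (r i, c j) = F $$ (i, j)"
proof -
  obtain I J where "perm_equiv (submatrix A I J) F" using assms unfolding configuration_def by blast
  then obtain p q where d: "dim_row F = card {i. i < dim_row A \<and> i \<in> I}" "dim_col F = card {i. i < dim_col A \<and> i \<in> J}"
    and p: "p permutes {..<dim_row F}" and q: "q permutes {..<dim_col F}"
    and eq: "\<forall>i<dim_row F. \<forall>j<dim_col F. submatrix A I J $$ (i, j) = F $$ (p i, q j)"
    unfolding perm_equiv_def dim_submatrix by metis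
  note pi = permutes_inv[OF p] and qi = permutes_inv[OF q]
  have pi_lt: "inv_into UNIV p i < dim_row F" if "i < dim_row F" for i using permutes_in_image[OF pi, of i] that by simp
  have qi_lt: "inv_into UNIV q i < dim_col F" if "i < dim_col F" for i using permutes_in_image[OF qi, of i] that by simp
  show thesis
  proof (rule that[of "pick I \<circ> inv_into UNIV p" "pick J \<circ> inv_into UNIV q"])
    show "inj_on (pick I \<circ> inv_into UNIV p) {..<dim_row F}"
      using inj_on_pick_below(1)[OF d(1)] permutes_inj_on[OF pi] by (intro comp_inj_on) (simp_all add: permutes_image[OF pi])
    show "inj_on (pick J \<circ> inv_into UNIV q) {..<dim_col F}"
      using inj_on_pick_below(1)[OF d(2)] permutes_inj_on[OF qi] by (intro comp_inj_on) (simp_all add: permutes_image[OF qi])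
    show "(pick I \<circ> inv_into UNIV p) ` {..<dim_row F} \<subseteq> {..<dim_row A}"
      using inj_on_pick_below(2)[OF d(1)] by (simp only: image_comp[symmetric] permutes_image[OF pi])
    show "(pick J \<circ> inv_into UNIV q) ` {..<dim_col F} \<subseteq> {..<dim_col A}"
      using inj_on_pick_below(2)[OF d(2)] by (simp only: image_comp[symmetric] permutes_image[OF qi])
    show "\<forall>i<dim_row F. \<forall>j<dim_col F. A $$ ((pick I \<circ> inv_into UNIV p) i, (pick J \<circ> inv_into UNIV q) j) = F $$ (i, j)"
    proof (intro allI impI)
      fix i j assume ij: "i < dim_row F" "j < dim_col F"
      have "submatrix A I J $$ (inv_into UNIV p i, inv_into UNIV q j) = F $$ (p (inv_into UNIV p i), q (inv_into UNIV q j))"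
        using eq pi_lt[OF ij(1)] qi_lt[OF ij(2)] by blast
      then show "A $$ ((pick I \<circ> inv_into UNIV p) i, (pick J \<circ> inv_into UNIV q) j) = F $$ (i, j)"
        using submatrix_index[of "inv_into UNIV p i" A I "inv_into UNIV q j" J] pi_lt[OF ij(1)] qi_lt[OF ij(2)]
        by (simp add: permutes_inverses[OF p] permutes_inverses[OF q] d)
    qed
  qed
qed

section \<open>The configuration F(0,p,1,0)\<close>

lemma dim_F0p10 [simp]: "dim_row (F0p10 p) = 2" "dim_col (F0p10 p) = Suc p"
  by (simp_all add: F0p10_def mat_of_cols_list_def)

lemma F0p10_entries [simp]:
  "j < Suc p \<Longrightarrow> F0p10 p $$ (0, j) = of_bool (j < p)"
  "j < Suc p \<Longrightarrow> F0p10 p $$ (Suc 0, j) = of_bool (j = p)"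
  by (auto simp: F0p10_def mat_of_cols_list_def nth_append)

lemma F0p10_configuration_iff:
  "F0p10 p \<prec> A \<longleftrightarrow> (\<exists>i<dim_row A. \<exists>j<dim_row A. i \<noteq> j \<and> p \<le> card (cols01 A i j) \<and> cols01 A j i \<noteq> {})"
proof
  assume "F0p10 p \<prec> A"
  then obtain r c where r: "inj_on r {..<2}" "r ` {..<2} \<subseteq> {..<dim_row A}"
    and c: "inj_on c {..<Suc p}" "c ` {..<Suc p} \<subseteq> {..<dim_col A}"
    and eq: "\<forall>i<2. \<forall>j<Suc p. A $$ (r i, c j) = F0p10 p $$ (i, j)"
    by (rule configurationE) simp
  have "r 0 \<noteq> r 1" using inj_onD[OF r(1), of 0 1] by auto
  moreover have "r 0 < dim_row A" "r 1 < dim_row A" using r(2) by (auto simp: image_subset_iff)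
  moreover have "c ` {..<p} \<subseteq> cols01 A (r 1) (r 0)"
    using c(2) eq by (auto simp: cols01_def image_subset_iff)
  then have "card (c ` {..<p}) \<le> card (cols01 A (r 1) (r 0))"
    by (rule card_mono[rotated]) (simp add: cols01_def)
  moreover have "card (c ` {..<p}) = p"
    using inj_on_subset[OF c(1), of "{..<p}"] by (simp add: card_image)
  moreover have "c p \<in> cols01 A (r 0) (r 1)"
    using c(2) eq by (auto simp: cols01_def image_subset_iff)
  ultimately show "\<exists>i<dim_row A. \<exists>j<dim_row A. i \<noteq> j \<and> p \<le> card (cols01 A i j) \<and> cols01 A j i \<noteq> {}"
    by (intro exI[of _ "r 1"] conjI exI[of _ "r 0"]) auto
next
  assume "\<exists>i<dim_row A. \<exists>j<dim_row A. i \<noteq> j \<and> p \<le> card (cols01 A i j) \<and> cols01 A j i \<noteq> {}"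
  then obtain i j b where ij: "i < dim_row A" "j < dim_row A" "i \<noteq> j" "p \<le> card (cols01 A i j)"
    and b: "b \<in> cols01 A j i" by blast
  obtain T where T: "T \<subseteq> cols01 A i j" "card T = p" "finite T"
    using obtain_subset_with_card_n[OF ij(4)] by metis
  obtain h where h: "bij_betw h {..<p} T"
    using ex_bij_betw_nat_finite[OF T(3)] T(2) by (auto simp: atLeast0LessThan)
  have hT: "h k \<in> cols01 A i j" if "k < p" for k using bij_betwE[OF h] that T(1) by blast
  \<comment> \<open>The rows are taken in the order \<open>j\<close>, \<open>i\<close>, since the
    first row of \<open>F0p10\<close> has its ones in the \<open>p\<close> equal columns and
    \<open>cols01 A i j\<close> has them in row \<open>j\<close>. The column \<open>b\<close> plays
    the last column.\<close>
  let ?c = "\<lambda>k. if k < p then h k else b" and ?r = "\<lambda>k. if k = 0 then j else i"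
  show "F0p10 p \<prec> A"
  proof (rule configurationI[of ?r _ _ ?c])
    show "inj_on ?r {..<dim_row (F0p10 p)}" using ij(3) by (auto simp: inj_on_def less_2_cases_iff)
    show "?r ` {..<dim_row (F0p10 p)} \<subseteq> {..<dim_row A}" using ij by auto
    have "b \<notin> cols01 A i j" using b by (auto simp: cols01_def)
    then have "h k \<noteq> b" if "k < p" for k using hT[OF that] by metis
    moreover have "inj_on h {..<p}" using h by (rule bij_betw_imp_inj_on)
    ultimately show "inj_on ?c {..<dim_col (F0p10 p)}" by (fastforce simp: inj_on_def less_Suc_eq)
    show "?c ` {..<dim_col (F0p10 p)} \<subseteq> {..<dim_col A}"
      using hT b by (auto simp: cols01_def)
    fix k l assume kl: "k < dim_row (F0p10 p)" "l < dim_col (F0p10 p)"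
    then have "k = 0 \<or> k = Suc 0" "l < p \<or> l = p" by auto
    then show "A $$ (?r k, ?c l) = F0p10 p $$ (k, l)"
      using hT[of l] b by (auto simp: cols01_def)
  qed
qed

section \<open>Simple matrices as families of column supports\<close>

definition col_support :: "nat mat \<Rightarrow> nat \<Rightarrow> nat set" where
  "col_support A c = {i. i < dim_row A \<and> A $$ (i, c) = 1}"

definition col_family :: "nat mat \<Rightarrow> nat set set" where
  "col_family A = col_support A ` {..<dim_col A}"

lemma simple_mat_entry:
  "\<lbrakk>simple_mat A; i < dim_row A; c < dim_col A\<rbrakk> \<Longrightarrow> A $$ (i, c) = of_bool (i \<in> col_support A c)"
  using elements_matI[of A "dim_row A" "dim_col A" i c] by (auto simp: simple_mat_def col_support_def)

lemma inj_on_col_support: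
  assumes "simple_mat A"
  shows "inj_on (col_support A) {..<dim_col A}"
proof (rule inj_onI)
  fix c d assume cd: "c \<in> {..<dim_col A}" "d \<in> {..<dim_col A}" "col_support A c = col_support A d"
  have "col A c = col A d"
    using cd simple_mat_entry[OF assms] by (intro eq_vecI) auto
  then have "cols A ! c = cols A ! d" using cd by simp
  then show "c = d" using assms cd nth_eq_iff_index_eq[of "cols A" c d] by (simp add: simple_mat_def)
qed

lemma col_support_image_cols01:
  assumes "simple_mat A" "i < dim_row A" "j < dim_row A"
  shows "col_support A ` cols01 A i j = separating (col_family A) i j"
  using assms by (auto simp: cols01_def separating_def col_family_def simple_mat_entry of_bool_eq_1_iff
      simp del: One_nat_def)

lemma card_cols01:
  assumes "simple_mat A" "i < dim_row A" "j < dim_row A"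
  shows "card (cols01 A i j) = card (separating (col_family A) i j)"
  unfolding col_support_image_cols01[OF assms, symmetric]
  by (rule card_image[symmetric], rule inj_on_subset[OF inj_on_col_support[OF assms(1)]])
    (auto simp: cols01_def)

lemma cols01_empty_iff:
  assumes "simple_mat A" "i < dim_row A" "j < dim_row A"
  shows "cols01 A i j = {} \<longleftrightarrow> separating (col_family A) i j = {}"
  unfolding col_support_image_cols01[OF assms, symmetric] by simp

lemma card_col_family: "simple_mat A \<Longrightarrow> card (col_family A) = dim_col A"
  by (simp add: col_family_def card_image inj_on_col_support)

lemma col_family_subset: "col_family A \<subseteq> Pow {..<dim_row A}"
  by (auto simp: col_family_def col_support_def)

lemma Avoid_iff:
  assumes "simple_mat A"
  shows "A \<in> Avoid m (F0p10 3) \<longleftrightarrow> dim_row A = m \<and> avoiding_family {..<m} (col_family A)"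
proof (cases "dim_row A = m")
  case True
  have "\<not> F0p10 3 \<prec> A \<longleftrightarrow> (\<forall>i<m. \<forall>j<m. i \<noteq> j \<longrightarrow> separating (col_family A) j i \<noteq> {} \<longrightarrow>
      card (separating (col_family A) i j) \<le> 2)"
    unfolding F0p10_configuration_iff using assms True
    by (auto simp: card_cols01 cols01_empty_iff not_le numeral_3_eq_3 numeral_2_eq_2 less_Suc_eq_le)
  then show ?thesis
    using assms True col_family_subset[of A] by (auto simp: Avoid_def avoiding_family_def)
qed (simp add: Avoid_def)

lemma dim_col_le_forb:
  assumes "A \<in> Avoid m F"
  shows "dim_col A \<le> forb m F"
proof -
  \<comment> \<open>This bound makes the set under \<open>Max\<close> in \<open>forb\<close>
    finite.\<close>
  have "dim_col B \<le> 2 ^ m" if "B \<in> Avoid m F" for B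
  proof -
    have "dim_col B = card (col_family B)" using that by (simp add: Avoid_def card_col_family)
    also have "\<dots> \<le> card (Pow {..<m})"
      using that col_family_subset[of B] by (intro card_mono) (auto simp: Avoid_def)
    finally show ?thesis by (simp add: card_Pow)
  qed
  then have "dim_col ` Avoid m F \<subseteq> {..2 ^ m}" by auto
  then have "finite (dim_col ` Avoid m F)" by (rule finite_subset) simp
  then show ?thesis unfolding forb_def using assms by (intro Max_ge) auto
qed

text \<open>The incidence matrix of an enumeration of \<open>F\<close> without repetitions is simple
  and has \<open>F\<close> as its family of column supports.\<close>

lemma card_le_forb:
  assumes "avoiding_family {..<m} F"
  shows "card F \<le> forb m (F0p10 3)"
proof -
  interpret avoiding_family "{..<m}" F by fact
  obtain fs where fs: "set fs = F" "distinct fs" using finite_distinct_list[OF finite_F] by blast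
  define A where "A = mat m (length fs) (\<lambda>(i, c). of_bool (i \<in> fs ! c) :: nat)"
  have dim: "dim_row A = m" "dim_col A = length fs" by (simp_all add: A_def)
  have supp: "col_support A c = fs ! c" if "c < length fs" for c
  proof -
    have "fs ! c \<subseteq> {..<m}" using fs(1) F_subset nth_mem[OF that] by blast
    then show ?thesis using that
      by (auto simp: col_support_def A_def of_bool_eq_1_iff simp del: One_nat_def)
  qed
  have fam: "col_family A = F"
    using supp fs(1) by (auto simp: col_family_def dim in_set_conv_nth image_iff)
  have "distinct (cols A)"
  proof (subst distinct_conv_nth, intro allI impI)
    fix c d assume cd: "c < length (cols A)" "d < length (cols A)" "c \<noteq> d"
    then have cd': "c < length fs" "d < length fs" by (simp_all add: dim)
    show "cols A ! c \<noteq> cols A ! d"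
    proof
      assume "cols A ! c = cols A ! d"
      then have eq: "col A c = col A d" using cd by simp
      have "A $$ (i, c) = A $$ (i, d)" if "i < m" for i
        using arg_cong[OF eq, of "\<lambda>v. v $ i"] that cd' by (simp add: dim)
      then have "col_support A c = col_support A d" by (auto simp: col_support_def dim)
      then show False using supp cd' cd(3) fs(2) by (simp add: nth_eq_iff_index_eq)
    qed
  qed
  moreover have "elements_mat A \<subseteq> {0, 1}"
    by (auto simp: A_def)
  ultimately have simple: "simple_mat A" by (simp add: simple_mat_def)
  have "A \<in> Avoid m (F0p10 3)" using Avoid_iff[OF simple] fam assms dim by simp
  then have "dim_col A \<le> forb m (F0p10 3)" by (rule dim_col_le_forb)
  then show ?thesis using fs by (simp add: dim distinct_card[symmetric])
qed

section \<open>A lower bound on forb\<close>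

text \<open>Take the empty set, the full set, the singletons and their complements. Only {j} and the
  complement of {i} contain j and miss i. From \<open>n\<close> = 3 on, singletons differ from
  complements, so all \<open>2 * n + 2\<close> sets are distinct.\<close>

lemma small_avoiding_family:
  fixes n :: nat
  assumes n: "3 \<le> n"
  shows "\<exists>F. avoiding_family {..<n} F \<and> {..<n} \<in> F \<and> card F = 2 * n + 2"
proof -
  let ?X = "(\<lambda>x. {x}) ` {..<n}" and ?Y = "(\<lambda>x. {..<n} - {x}) ` {..<n}"
  let ?F = "{{}, {..<n}} \<union> (?X \<union> ?Y)"
  have "card ?X = n" by (simp add: card_image)
  moreover have "card ?Y = n" by (subst card_image) (auto simp: inj_on_def)
  moreover have card_Y: "card S = n - 1" if "S \<in> ?Y" for S using that by auto
  have "card S \<noteq> card T" if "S \<in> ?X" "T \<in> ?Y" for S T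
    using card_Y[OF that(2)] that(1) n by auto
  then have "?X \<inter> ?Y = {}" by blast
  moreover have "card ({{}, {..<n}} :: nat set set) = 2" using n by (subst card_2_iff) force
  moreover have "{{}, {..<n}} \<inter> (?X \<union> ?Y) = {}"
  proof -
    have "card S \<noteq> 0 \<and> card S \<noteq> n" if "S \<in> ?X \<union> ?Y" for S
      using that card_Y[of S] n by auto
    then have "{} \<notin> ?X \<union> ?Y" "{..<n} \<notin> ?X \<union> ?Y" by (metis card.empty, metis card_lessThan)
    then show ?thesis by (simp only: Int_insert_left if_False Int_empty_left)
  qed
  ultimately have "card ?F = 2 * n + 2"
    by (subst card_Un_disjoint) (simp_all add: card_Un_disjoint)
  moreover have "avoiding_family {..<n} ?F"
  proof
    fix i j assume "i \<in> {..<n}" "j \<in> {..<n}" "i \<noteq> j"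
    then have "separating ?F i j \<subseteq> {{j}, {..<n} - {i}}" by (auto simp: separating_def)
    then have "card (separating ?F i j) \<le> card {{j}, {..<n} - {i}}" by (intro card_mono) auto
    also have "\<dots> \<le> 2" by (simp add: card_insert_if)
    finally show "card (separating ?F i j) \<le> 2" .
  qed auto
  ultimately show ?thesis by (intro exI[of _ ?F]) auto
qed

text \<open>Three rows are added, and for each nonempty set T of them the set
  \<open>{..<m} \<union> T\<close>; for empty T it is already in \<open>F\<close>. Sets that meet
  the new rows contain all old ones, so no new set separates two old rows, and old and new rows are
  joined by directed edges.\<close>

lemma extend_avoiding_family:
  fixes m :: nat
  assumes F: "avoiding_family {..<m} F" "{..<m} \<in> F"
  shows "\<exists>F'. avoiding_family {..<m + 3} F' \<and> {..<m + 3} \<in> F' \<and> card F' = card F + 7"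
proof -
  interpret avoiding_family "{..<m}" F by fact
  let ?U = "{m, m + 1, m + 2 :: nat}"
  let ?N = "(\<lambda>T. {..<m} \<union> T) ` (Pow ?U - {{}})"
  let ?F = "F \<union> ?N"
  have "inj_on (\<lambda>T. {..<m} \<union> T) (Pow ?U - {{}})"
    by (rule inj_on_inverseI[of _ "\<lambda>S. S - {..<m}"]) auto
  then have "card ?N = card (Pow ?U - {{}})" by (rule card_image)
  also have "\<dots> = 7" by (subst card_Diff_subset) (simp_all add: card_Pow)
  finally have cN: "card ?N = 7" .
  have "F \<inter> ?N = {}"
  proof -
    have "\<not> S \<subseteq> {..<m}" if "S \<in> ?N" for S
    proof -
      obtain T x where T: "S = {..<m} \<union> T" "T \<subseteq> ?U" "x \<in> T" using \<open>S \<in> ?N\<close> by auto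
      then have "m \<le> x" by auto
      then show ?thesis using T by (auto simp: not_less)
    qed
    then show ?thesis using F_subset by blast
  qed
  then have "card ?F = card F + 7" using cN finite_F by (simp add: card_Un_disjoint)
  moreover have "{..<m + 3} \<in> ?N"
  proof -
    have "{..<m + 3} = {..<m} \<union> ?U" by auto
    then show ?thesis by blast
  qed
  moreover have "avoiding_family {..<m + 3} ?F"
  proof
    have "F \<subseteq> Pow {..<m + 3}" using F_subset by (rule order_trans) auto
    then show "?F \<subseteq> Pow {..<m + 3}" by auto
    fix i j assume ij: "i \<in> {..<m + 3}" "j \<in> {..<m + 3}" "i \<noteq> j" "separating ?F j i \<noteq> {}"
    have old: "b \<notin> S" if "m \<le> b" "S \<in> F" for b S
      using subsetD[OF F_subset that(2)] that(1) by auto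
    have new: "separating ?F a b = {}" if "a < m" "m \<le> b" for a b
      using old that by (auto simp: separating_def)
    consider "i < m" "j < m" | "i < m" "m \<le> j" | "m \<le> i" "j < m" | "m \<le> i" "m \<le> j" by linarith
    then show "card (separating ?F i j) \<le> 2"
    proof cases
      case 1
      then have "separating ?F i j = separating F i j" "separating ?F j i = separating F j i"
        by (auto simp: separating_def)
      then show ?thesis using avoid[of i j] 1 ij by simp
    next
      case 2
      then show ?thesis using new by simp
    next
      case 3
      then show ?thesis using new[of j i] ij(4) by simp
    next
      case 4
      then have ijU: "i \<in> ?U" "j \<in> ?U" using ij by auto
      \<comment> \<open>Only the third new row is free to lie in the set or not, which leaves two
        sets.\<close>
      have "separating ?F i j \<subseteq> (\<lambda>X. {..<m} \<union> insert j X) ` Pow (?U - {i, j})"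
      proof
        fix S assume S: "S \<in> separating ?F i j"
        then have "j \<in> S" by (simp add: separating_def)
        then have "S \<notin> F" using old 4 by blast
        then obtain T where T: "T \<subseteq> ?U" "S = {..<m} \<union> T" using S by (auto simp: separating_def)
        then have "i \<notin> T" "j \<in> T" using S 4 by (auto simp: separating_def)
        then have "T = insert j (T - {j})" "T - {j} \<in> Pow (?U - {i, j})" using T by auto
        then show "S \<in> (\<lambda>X. {..<m} \<union> insert j X) ` Pow (?U - {i, j})" using T(2) by blast
      qed
      then have "card (separating ?F i j) \<le> card ((\<lambda>X. {..<m} \<union> insert j X) ` Pow (?U - {i, j}))"
        by (intro card_mono) auto
      also have "\<dots> \<le> card (Pow (?U - {i, j}))" by (intro card_image_le) auto
      also have "\<dots> = 2 ^ card (?U - {i, j})" by (simp add: card_Pow)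
      also have "card (?U - {i, j}) = 1" using ijU ij(3) by (subst card_Diff_subset) auto
      finally show ?thesis by simp
    qed
  qed auto
  ultimately show ?thesis by (intro exI[of _ ?F]) blast
qed

text \<open>For \<open>m\<close> = 3, 4, 5 the \<open>2 * m + 2\<close> sets of a single block
  attain the value. Three more rows bring seven more sets, which adds 21 to both sides.\<close>

lemma large_avoiding_family:
  fixes m :: nat
  shows "3 \<le> m \<Longrightarrow> \<exists>F. avoiding_family {..<m} F \<and> {..<m} \<in> F \<and> 3 * card F + m mod 3 = 7 * m + 3"
proof (induction m rule: less_induct)
  case (less m)
  show ?case
  proof (cases "m < 6")
    case True
    then have "m \<in> {3, 4, 5}" using less.prems by auto
    then show ?thesis using small_avoiding_family[OF less.prems] by auto
  next
    case False
    then have "m - 3 < m" "3 \<le> m - 3" by simp_all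
    then obtain F where F: "avoiding_family {..<m - 3} F" "{..<m - 3} \<in> F"
      "3 * card F + (m - 3) mod 3 = 7 * (m - 3) + 3"
      using less.IH by blast
    obtain F' where F': "avoiding_family {..<m - 3 + 3} F'" "{..<m - 3 + 3} \<in> F'" "card F' = card F + 7"
      using extend_avoiding_family[OF F(1,2)] by blast
    have "m - 3 + 3 = m" "(m - 3) mod 3 = m mod 3" using False mod_add_self2[of "m - 3" 3] by auto
    then show ?thesis using F' F(3) False by (intro exI[of _ F']) auto
  qed
qed

lemma forb_ge: "3 \<le> m \<Longrightarrow> 7 * m + 3 \<le> 3 * forb m (F0p10 3) + m mod 3"
  using large_avoiding_family[of m] card_le_forb[of m] by fastforce

section \<open>The blocks\<close>

text \<open>Columns are compared as vectors: as \<open>M\<close> repeats no column, following the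
  list \<open>cols M\<close> by the inverse of the given bijection matches the column
  indices.\<close>

lemma perm_equiv_submatrix_cols:
  assumes M: "distinct (cols M)"
    and r: "bij_betw r {..<dim_row M} I" "I \<subseteq> {..<dim_row A}" and J: "J \<subseteq> {..<dim_col A}"
    and f: "bij_betw (\<lambda>c. vec (dim_row M) (\<lambda>i. A $$ (r i, c))) J (set (cols M))"
  shows "perm_equiv (submatrix A I J) M"
proof (rule perm_equiv_submatrixI[OF r _ J])
  let ?f = "\<lambda>c. vec (dim_row M) (\<lambda>i. A $$ (r i, c))"
  let ?c = "the_inv_into J ?f \<circ> (!) (cols M)"
  have n: "bij_betw ((!) (cols M)) {..<dim_col M} (set (cols M))"
    using M by (rule bij_betw_nth) simp_all
  show "bij_betw ?c {..<dim_col M} J" using n bij_betw_the_inv_into[OF f] by (rule bij_betw_trans)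
  fix i j assume ij: "i < dim_row M" "j < dim_col M"
  have eq: "?f (?c j) = cols M ! j"
    using f_the_inv_into_f_bij_betw[OF f] bij_betwE[OF n] ij by simp
  have "A $$ (r i, ?c j) = ?f (?c j) $ i" using ij by simp
  also have "\<dots> = cols M ! j $ i" by (simp only: eq)
  finally show "A $$ (r i, ?c j) = M $$ (i, j)" using ij by simp
qed

section \<open>The columns of \<open>K\<close> and of the matrices built from it\<close>

lemma distinct_product_lists:
  "\<forall>xs\<in>set xss. distinct xs \<Longrightarrow> distinct (product_lists xss)"
proof (induction xss)
  case (Cons xs xss)
  then have "distinct xs" "distinct (product_lists xss)" by simp_all
  then show ?case
    by (induction xs) (auto simp: distinct_map)
qed simp

lemma cols_K: "cols (K k) = map (\<lambda>l. vec k ((!) l)) (product_lists (replicate k [0, 1]))"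
  by (intro nth_equalityI) (auto simp: K_def mat_of_cols_list_def)

lemma set_product_lists_01: "set (product_lists (replicate k [0, 1 :: nat])) = {l. length l = k \<and> set l \<subseteq> {0, 1}}"
proof -
  have "list_all2 (\<lambda>x ys. x \<in> set ys) l (replicate k [0, 1 :: nat]) \<longleftrightarrow> length l = k \<and> set l \<subseteq> {0, 1}" for l
    by (induction k arbitrary: l) (auto simp: list_all2_Cons2 length_Suc_conv)
  then show ?thesis by (simp add: product_lists_set)
qed

lemma set_cols_K: "set (cols (K k)) = {v \<in> carrier_vec k. \<forall>i<k. v $ i \<in> {0, 1}}"
proof (intro equalityI subsetI)
  fix v assume "v \<in> {v \<in> carrier_vec k. \<forall>i<k. v $ i \<in> {0, 1 :: nat}}"
  then have v: "dim_vec v = k" "\<forall>i<k. v $ i \<in> {0, 1}" by auto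
  then have "v = vec k ((!) (list_of_vec v))" "list_of_vec v \<in> {l. length l = k \<and> set l \<subseteq> {0, 1}}"
    by (auto simp: set_conv_nth list_of_vec_index)
  then show "v \<in> set (cols (K k))" unfolding cols_K set_map set_product_lists_01 by blast
next
  fix v assume "v \<in> set (cols (K k))"
  then obtain l where l: "v = vec k ((!) l)" "length l = k" "set l \<subseteq> {0, 1}"
    unfolding cols_K set_map set_product_lists_01 by blast
  have "l ! i \<in> {0, 1}" if "i < k" for i using l(2,3) nth_mem[of i l] that by blast
  then show "v \<in> {v \<in> carrier_vec k. \<forall>i<k. v $ i \<in> {0, 1}}" using l(1) by simp
qed

lemma distinct_cols_K: "distinct (cols (K k))"
proof -
  have "inj_on (\<lambda>l. vec k ((!) l)) {l. length l = k \<and> set l \<subseteq> {0, 1 :: nat}}"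
  proof (rule inj_onI)
    fix l l' :: "nat list"
    assume l: "l \<in> {l. length l = k \<and> set l \<subseteq> {0, 1}}" "l' \<in> {l. length l = k \<and> set l \<subseteq> {0, 1}}"
      and eq: "vec k ((!) l) = vec k ((!) l')"
    have "l ! i = l' ! i" if "i < k" for i using arg_cong[OF eq, of "\<lambda>v. v $ i"] that by simp
    then show "l = l'" using l by (intro nth_equalityI) auto
  qed
  then show ?thesis
    unfolding cols_K distinct_map set_product_lists_01 by (auto intro: distinct_product_lists)
qed

abbreviation vec_sum :: "nat vec \<Rightarrow> nat" where
  "vec_sum v \<equiv> sum_list (list_of_vec v)"

lemma cols_K_carrier: "set (cols (K k)) \<subseteq> carrier_vec k"
  by (auto simp: set_cols_K)

lemma cols_Ks: "cols (Ks k s) = filter (\<lambda>v. vec_sum v = s) (cols (K k))"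
  unfolding Ks_def using cols_K_carrier[of k] by (intro cols_mat_of_cols) auto

lemma dim_row_Ks [simp]: "dim_row (Ks k s) = k"
  by (simp add: Ks_def)

lemma dim_row_hconcat [simp]: "dim_row (A ||| B) = dim_row A"
  by (simp add: hconcat_def)

lemma cols_hconcat: "dim_row B = dim_row A \<Longrightarrow> cols (A ||| B) = cols A @ cols B"
  unfolding hconcat_def using cols_dim[of A] cols_dim[of B] by (intro cols_mat_of_cols) auto

lemma cols_hconcat_Ks:
  assumes "distinct [s, t, u]"
  shows "distinct (cols (Ks k s ||| Ks k t ||| Ks k u))"
    and "set (cols (Ks k s ||| Ks k t ||| Ks k u)) = {v \<in> set (cols (K k)). vec_sum v \<in> {s, t, u}}"
  using assms distinct_cols_K[of k] by (auto simp: cols_hconcat cols_Ks)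

lemma cols_K_without_ones: "cols (K_without_ones k) = removeAll (vec k (\<lambda>_. 1)) (cols (K k))"
  unfolding K_without_ones_def using cols_K_carrier[of k] by (intro cols_mat_of_cols) auto

lemma dim_row_K_without_ones [simp]: "dim_row (K_without_ones k) = k"
  by (simp add: K_without_ones_def)

lemma vec_sum_eq: "vec_sum v = (\<Sum>i<dim_vec v. v $ i)"
  by (simp add: list_of_vec_map interv_sum_list_conv_sum_set_nat atLeast0LessThan)

text \<open>Only the all-1 column has sum 3. This puts size 3 into the common pattern of column sums
  0, 1 and n - 1.\<close>

lemma set_cols_K_without_ones:
  "set (cols (K_without_ones 3)) = {v \<in> set (cols (K 3)). vec_sum v \<in> {0, 1, 2}}"
proof -
  have "v \<noteq> vec 3 (\<lambda>_. 1) \<longleftrightarrow> vec_sum v \<in> {0, 1, 2}" if "v \<in> set (cols (K 3))" for v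
  proof -
    have v: "dim_vec v = 3" "v $ 0 \<in> {0, 1}" "v $ 1 \<in> {0, 1}" "v $ 2 \<in> {0, 1}"
      using that by (auto simp: set_cols_K)
    have "v = vec 3 (\<lambda>_. 1) \<longleftrightarrow> v $ 0 = 1 \<and> v $ 1 = 1 \<and> v $ 2 = 1"
      using v(1) by (auto simp: vec_eq_iff numeral_3_eq_3 less_Suc_eq numeral_2_eq_2)
    moreover have "vec_sum v = v $ 0 + v $ 1 + v $ 2"
      using v(1) by (simp add: vec_sum_eq numeral_3_eq_3 numeral_2_eq_2)
    ultimately show ?thesis using v by auto
  qed
  then show ?thesis by (auto simp: cols_K_without_ones)
qed

text \<open>Applied to the excesses \<open>card C - 3\<close>, this yields the two alternatives for
  \<open>m mod 3 = 2\<close>.\<close>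

lemma sum_eq_2_cases:
  fixes f :: "'a \<Rightarrow> nat"
  assumes "finite A" "sum f A = 2"
  shows "(\<exists>a\<in>A. f a = 2 \<and> (\<forall>x\<in>A - {a}. f x = 0)) \<or>
    (\<exists>a\<in>A. \<exists>b\<in>A. a \<noteq> b \<and> f a = 1 \<and> f b = 1 \<and> (\<forall>x\<in>A - {a, b}. f x = 0))"
proof -
  obtain a where a: "a \<in> A" "f a \<noteq> 0" using assms by (metis sum.neutral zero_neq_numeral)
  have s: "f a + sum f (A - {a}) = 2" using assms a by (simp add: sum.remove)
  show ?thesis
  proof (cases "f a = 2")
    case True
    then show ?thesis using s a assms(1) by auto
  next
    case False
    then have 1: "f a = 1" "sum f (A - {a}) = Suc 0" using s a(2) by auto
    then obtain b where "b \<in> A - {a}" "f b = Suc 0" "\<forall>x\<in>A - {a}. b \<noteq> x \<longrightarrow> f x = 0"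
      using sum_eq_Suc0_iff[of "A - {a}" f] assms(1) by auto
    then show ?thesis using 1(1) a(1) by (intro disjI2 bexI[of _ a] bexI[of _ b]) auto
  qed
qed

section \<open>From traces to blocks\<close>

lemma bij_betw_indicator_vec:
  assumes r: "bij_betw r {..<n} C"
  shows "bij_betw (\<lambda>T. vec n (\<lambda>i. of_bool (r i \<in> T))) (Pow C) (set (cols (K n)))"
proof (rule bij_betwI[where g = "\<lambda>v. r ` {i. i < n \<and> v $ i = 1}"])
  show "(\<lambda>T. vec n (\<lambda>i. of_bool (r i \<in> T))) \<in> Pow C \<rightarrow> set (cols (K n))"
    by (auto simp: set_cols_K)
  show "(\<lambda>v. r ` {i. i < n \<and> v $ i = 1}) \<in> set (cols (K n)) \<rightarrow> Pow C"
    using r by (auto simp: bij_betw_def)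
  show "r ` {i. i < n \<and> vec n (\<lambda>i. of_bool (r i \<in> T)) $ i = (1 :: nat)} = T" if "T \<in> Pow C" for T
  proof -
    have "{i. i < n \<and> vec n (\<lambda>i. of_bool (r i \<in> T)) $ i = (1 :: nat)} = {i. i < n \<and> r i \<in> T}"
      by (auto simp del: One_nat_def simp: of_bool_eq_1_iff)
    then show ?thesis using that r by (auto simp: bij_betw_def)
  qed
  show "vec n (\<lambda>i. of_bool (r i \<in> r ` {i. i < n \<and> v $ i = 1})) = v" if "v \<in> set (cols (K n))" for v
  proof -
    have "r i \<in> r ` {i. i < n \<and> v $ i = 1} \<longleftrightarrow> v $ i = 1" if "i < n" for i
      using that inj_on_image_mem_iff[OF bij_betw_imp_inj_on[OF r], of i "{i. i < n \<and> v $ i = 1}"] by auto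
    then show ?thesis using that by (intro eq_vecI) (auto simp: set_cols_K)
  qed
qed

lemma vec_sum_indicator:
  assumes r: "bij_betw r {..<n} C" and T: "T \<subseteq> C"
  shows "vec_sum (vec n (\<lambda>i. of_bool (r i \<in> T))) = card T"
proof -
  have "vec_sum (vec n (\<lambda>i. of_bool (r i \<in> T))) = (\<Sum>i<n. of_bool (r i \<in> T))"
    unfolding vec_sum_eq by simp
  also have "\<dots> = (\<Sum>x\<in>C. of_bool (x \<in> T))"
    using r by (rule sum.reindex_bij_betw)
  also have "\<dots> = card T"
    using T bij_betw_finite[OF r] by (simp add: Int_absorb1)
  finally show ?thesis .
qed

lemma image_Collect_restrict:
  "(\<And>x. x \<in> X \<Longrightarrow> P (g x) \<longleftrightarrow> Q x) \<Longrightarrow> g ` {x \<in> X. Q x} = {y \<in> g ` X. P y}"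
  by blast

text \<open>The chosen zero column has empty trace on \<open>C\<close>, and the non-constant columns
  have each trace of size 1 or \<open>card C - 1\<close> once. Indicator vectors turn these traces
  into the columns with sum 0, 1 or \<open>card C - 1\<close>.\<close>

lemma perm_equiv_block:
  assumes A: "simple_mat A" and C: "C \<subseteq> {..<dim_row A}" "2 \<le> card C"
    and zero: "{} \<in> col_family A"
    and inj: "inj_on (\<lambda>S. S \<inter> C) (splitting (col_family A) C)"
    and traces: "(\<lambda>S. S \<inter> C) ` splitting (col_family A) C = {T. T \<subseteq> C \<and> (card T = 1 \<or> card T = card C - 1)}"
    and M: "distinct (cols M)" "dim_row M = card C"
      "set (cols M) = {v \<in> set (cols (K (card C))). vec_sum v \<in> {0, 1, card C - 1}}"
  shows "perm_equiv (block A C) M"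
proof -
  let ?n = "card C" and ?N = "nonconstant_cols A C" and ?s = "col_support A"
  have finC: "finite C" using C(2) card.infinite by fastforce
  obtain r where r: "bij_betw r {..<?n} C"
    using ex_bij_betw_nat_finite[OF finC] by (auto simp: atLeast0LessThan)
  define z where "z = (LEAST c. c \<in> zero_cols A C)"
  \<comment> \<open>The empty member of the family is the support of a column that vanishes on
    \<open>C\<close>, so the block does receive its zero column.\<close>
  obtain c0 where c0: "c0 < dim_col A" "?s c0 = {}" using zero by (auto simp: col_family_def)
  then have "c0 \<in> zero_cols A C"
    using C(1) simple_mat_entry[OF A] by (auto simp: zero_cols_def)
  then have z: "z \<in> zero_cols A C" and ne: "zero_cols A C \<noteq> {}"
    unfolding z_def by (auto intro: LeastI)
  let ?J = "insert z ?N"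
  have block: "block A C = submatrix A C ?J"
    using ne by (simp add: block_def z_def)
  have zlt: "z < dim_col A" using z by (simp add: zero_cols_def)
  have N_sub: "?N \<subseteq> {..<dim_col A}" by (auto simp: nonconstant_cols_def)
  have nonconst_iff: "c \<in> ?N \<longleftrightarrow> ?s c \<inter> C \<noteq> {} \<and> \<not> C \<subseteq> ?s c" if "c < dim_col A" for c
  proof -
    have "A $$ (i, c) \<noteq> A $$ (j, c) \<longleftrightarrow> (i \<in> ?s c) \<noteq> (j \<in> ?s c)" if "i \<in> C" "j \<in> C" for i j
      using that C(1) simple_mat_entry[OF A _ \<open>c < dim_col A\<close>] by (auto simp: subset_iff)
    then have "c \<in> ?N \<longleftrightarrow> (\<exists>i\<in>C. \<exists>j\<in>C. (i \<in> ?s c) \<noteq> (j \<in> ?s c))"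
      using that by (simp add: nonconstant_cols_def)
    then show ?thesis by blast
  qed
  have sN: "?s ` ?N = splitting (col_family A) C"
    using nonconst_iff N_sub by (auto simp: splitting_def col_family_def)
  define t where "t c = ?s c \<inter> C" for c
  have tz: "t z = {}" using z C(1) by (auto simp: zero_cols_def col_support_def t_def)
  have "inj_on ((\<lambda>S. S \<inter> C) \<circ> ?s) ?N"
    using inj_on_subset[OF inj_on_col_support[OF A] N_sub] inj sN by (intro comp_inj_on) simp_all
  then have tN: "inj_on t ?N" by (simp add: t_def[abs_def] comp_def)
  have "t z \<notin> t ` (?N - {z})"
    using nonconst_iff N_sub tz by (auto simp: t_def)
  then have t_inj: "inj_on t ?J" using tN by simp
  have "t ` ?N = (\<lambda>S. S \<inter> C) ` (?s ` ?N)" by (simp add: image_comp t_def comp_def)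
  then have t_image: "t ` ?J = {T \<in> Pow C. card T \<in> {0, 1, ?n - 1}}"
    using sN traces tz finC by (auto simp: finite_subset)
  let ?f = "\<lambda>T. vec ?n (\<lambda>i. of_bool (r i \<in> T)) :: nat vec"
  have f: "bij_betw ?f (Pow C) (set (cols (K ?n)))" by (rule bij_betw_indicator_vec[OF r])
  have "bij_betw ?f {T \<in> Pow C. card T \<in> {0, 1, ?n - 1}} (set (cols M))"
  proof (rule bij_betw_subset[OF f])
    show "?f ` {T \<in> Pow C. card T \<in> {0, 1, ?n - 1}} = set (cols M)"
      unfolding M(3) bij_betw_imp_surj_on[OF f, symmetric]
      using vec_sum_indicator[OF r] by (intro image_Collect_restrict) auto
  qed auto
  then have ft: "bij_betw (?f \<circ> t) ?J (set (cols M))"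
    using t_inj t_image by (intro bij_betw_trans[of t]) (auto simp: bij_betw_def)
  have eq: "(?f \<circ> t) c = vec (dim_row M) (\<lambda>i. A $$ (r i, c))" if "c \<in> ?J" for c
  proof -
    have "c < dim_col A" using that zlt N_sub by auto
    then have "A $$ (r i, c) = of_bool (r i \<in> t c)" if "i < ?n" for i
      using simple_mat_entry[OF A, of "r i" c] bij_betwE[OF r] that C(1) by (auto simp: t_def)
    then show ?thesis using M(2) by (intro eq_vecI) auto
  qed
  have "bij_betw (\<lambda>c. vec (dim_row M) (\<lambda>i. A $$ (r i, c))) ?J (set (cols M))"
    by (rule iffD1[OF bij_betw_cong ft]) (rule eq)
  then show ?thesis
    unfolding block using M(1,2) r C(1) N_sub zlt
    by (intro perm_equiv_submatrix_cols[of M r]) simp_all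
qed

section \<open>Extremal matrices\<close>

theorem theorem6:
  fixes m :: nat and A :: "nat mat"
  assumes "m \<ge> 3" and "A \<in> Ext m (F0p10 3)"
  shows "(\<forall>C\<in>components 3 A. \<forall>i\<in>C. \<forall>j\<in>C. i \<noteq> j \<longrightarrow> undirected_edge 3 A i j) \<and>
    (m mod 3 = 0 \<longrightarrow> (\<forall>C\<in>components 3 A. card C = 3)) \<and>
    (m mod 3 = 1 \<longrightarrow>
      (\<exists>D\<in>components 3 A. card D = 4 \<and> (\<forall>C\<in>components 3 A - {D}. card C = 3))) \<and>
    (m mod 3 = 2 \<longrightarrow>
      (\<exists>D\<in>components 3 A. card D = 5 \<and> (\<forall>C\<in>components 3 A - {D}. card C = 3)) \<or>
      (\<exists>D\<in>components 3 A. \<exists>E\<in>components 3 A. D \<noteq> E \<and> card D = 4 \<and> card E = 4 \<and>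
        (\<forall>C\<in>components 3 A - {D, E}. card C = 3))) \<and>
    (\<forall>C\<in>components 3 A.
      (card C = 3 \<longrightarrow> perm_equiv (block A C) (K_without_ones 3)) \<and>
      (card C = 4 \<longrightarrow> perm_equiv (block A C) (Ks 4 0 ||| Ks 4 1 ||| Ks 4 3)) \<and>
      (card C = 5 \<longrightarrow> perm_equiv (block A C) (Ks 5 0 ||| Ks 5 1 ||| Ks 5 4)))"
proof -
  have Av: "A \<in> Avoid m (F0p10 3)" and ext: "dim_col A = forb m (F0p10 3)"
    using assms(2) by (simp_all add: Ext_def)
  have simple: "simple_mat A" using Av by (simp add: Avoid_def)
  have dim: "dim_row A = m" and "avoiding_family {..<m} (col_family A)"
    using Av Avoid_iff[OF simple] by simp_all
  then interpret avoiding_family "{..<m}" "col_family A" by simp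
  have E: "(i, j) \<in> E \<longleftrightarrow> undirected_edge 3 A i j" for i j
    using card_cols01[OF simple] cols01_empty_iff[OF simple]
    by (auto simp: E_def undirected_edge_def directed_edge_def dim)
  have comps: "components 3 A = comps"
  proof -
    have "{(i, j). undirected_edge 3 A i j} = E" using E by auto
    then show ?thesis unfolding components_def comps_def dim by simp
  qed
  \<comment> \<open>Extremality enters here: the number of columns is \<open>forb\<close>, which is
    at least the size of a stack of blocks.\<close>
  have "7 * card {..<m} + 3 \<le> 3 * card (col_family A) + card {..<m} mod 3"
    using forb_ge[OF assms(1)] card_col_family[OF simple] ext by simp
  note str = large_family_structure[OF this, unfolded card_lessThan]
  have ge3: "3 \<le> card C" and cardN: "card (splitting (col_family A) C) = 2 * card C"
    and clique: "\<And>i j. \<lbrakk>i \<in> C; j \<in> C; i \<noteq> j\<rbrakk> \<Longrightarrow> (i, j) \<in> E" if "C \<in> comps" for C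
    using str(3)[OF that] by blast+
  have block: "perm_equiv (block A C) M"
    if "C \<in> comps" "distinct (cols M)" "dim_row M = card C"
      "set (cols M) = {v \<in> set (cols (K (card C))). vec_sum v \<in> {0, 1, card C - 1}}" for C M
    using perm_equiv_block[OF simple _ _ str(1) inj_on_trace[OF that(1)] _ that(2-4)]
      splitting_traces[OF that(1) _ clique[OF that(1)] cardN[OF that(1)]]
      comps_subset[OF that(1)] ge3[OF that(1)] dim by simp
  have blocks: "(card C = 3 \<longrightarrow> perm_equiv (block A C) (K_without_ones 3)) \<and>
      (card C = 4 \<longrightarrow> perm_equiv (block A C) (Ks 4 0 ||| Ks 4 1 ||| Ks 4 3)) \<and>
      (card C = 5 \<longrightarrow> perm_equiv (block A C) (Ks 5 0 ||| Ks 5 1 ||| Ks 5 4))" if "C \<in> comps" for C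
  proof (intro conjI impI)
    assume "card C = 3"
    then show "perm_equiv (block A C) (K_without_ones 3)"
      using distinct_cols_K[of 3] set_cols_K_without_ones
      by (intro block that) (simp_all add: cols_K_without_ones distinct_removeAll)
  next
    assume "card C = 4"
    then show "perm_equiv (block A C) (Ks 4 0 ||| Ks 4 1 ||| Ks 4 3)"
      using cols_hconcat_Ks[of 0 1 3 4] by (intro block that) simp_all
  next
    assume "card C = 5"
    then show "perm_equiv (block A C) (Ks 5 0 ||| Ks 5 1 ||| Ks 5 4)"
      using cols_hconcat_Ks[of 0 1 4 5] by (intro block that) simp_all
  qed
  \<comment> \<open>Every component has at least three elements, so the truncated excess
    \<open>card C - 3\<close> determines the size. The excesses add up to \<open>m mod 3\<close>,
    which gives the three cases.\<close>
  have size: "card C = k + 3" if "C \<in> comps" "card C - 3 = k" for C k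
    using ge3[OF that(1)] that(2) by simp
  have m0: "\<forall>C\<in>comps. card C = 3" if "m mod 3 = 0"
    using str(2) that size[of _ 0] finite_comps by auto
  have m1: "\<exists>D\<in>comps. card D = 4 \<and> (\<forall>C\<in>comps - {D}. card C = 3)" if "m mod 3 = 1"
  proof -
    have "(\<Sum>C\<in>comps. card C - 3) = Suc 0" using str(2) that by simp
    then obtain D where D: "D \<in> comps" "card D - 3 = 1" "\<forall>C\<in>comps. D \<noteq> C \<longrightarrow> card C - 3 = 0"
      using sum_eq_Suc0_iff[OF finite_comps, of "\<lambda>C. card C - 3"] by auto
    then show ?thesis using size[of D 1] size[of _ 0] by (intro bexI[of _ D]) auto
  qed
  have m2: "(\<exists>D\<in>comps. card D = 5 \<and> (\<forall>C\<in>comps - {D}. card C = 3)) \<or>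
      (\<exists>D\<in>comps. \<exists>E\<in>comps. D \<noteq> E \<and> card D = 4 \<and> card E = 4 \<and> (\<forall>C\<in>comps - {D, E}. card C = 3))"
    if "m mod 3 = 2"
  proof -
    have "(\<Sum>C\<in>comps. card C - 3) = 2" using str(2) that by simp
    from sum_eq_2_cases[OF finite_comps this] show ?thesis
    proof (elim disjE bexE conjE)
      fix D assume D: "D \<in> comps" "card D - 3 = 2" "\<forall>C\<in>comps - {D}. card C - 3 = 0"
      then show ?thesis using size[of D 2] size[of _ 0] by (intro disjI1 bexI[of _ D]) auto
    next
      fix D E assume D: "D \<in> comps" "E \<in> comps" "D \<noteq> E" "card D - 3 = 1" "card E - 3 = 1"
        "\<forall>C\<in>comps - {D, E}. card C - 3 = 0"
      then have "card D = 4" "card E = 4" "\<forall>C\<in>comps - {D, E}. card C = 3"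
        using size[of D 1] size[of E 1] size[of _ 0] by auto
      then show ?thesis using D by blast
    qed
  qed
  have "\<forall>C\<in>comps. \<forall>i\<in>C. \<forall>j\<in>C. i \<noteq> j \<longrightarrow> undirected_edge 3 A i j"
  proof (intro ballI impI)
    fix C i j assume "C \<in> comps" "i \<in> C" "j \<in> C" "i \<noteq> j"
    then have "(i, j) \<in> E" by (rule clique)
    then show "undirected_edge 3 A i j" by (simp only: E)
  qed
  then show ?thesis
    unfolding comps by (intro conjI impI m0 m1 m2 ballI[OF blocks]) assumption+
qed

end
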